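(* Let $K_1,K_2$ be $(i+1)$-path connected finite simplicial complexes. Then: (1) If $i=0$, then $K_1\Box K_2$ is $1$-path connected, and $\lambda_{\max}(\Delta_0^{up}(K_1\Box K_2))=2$ if and only if $B_0(K_1)$ and $B_0(K_2)$ are both balanced. (2) If $i\ge 1$, then $K_1\Box K_2$ is not $(i+1)$-path connected, and $\lambda_{\max}(\Delta_i^{up}(K_1\Box K_2))=i+2$ if and only if at least one of $B_i(K_1)$, $B_i(K_2)$ is balanced.
   Context: The Cartesian product $K_1\Box K_2$ is the complex on vertex set $V(K_1)\times V(K_2)$ whose faces are the sets $F\times\{v\}=\{(u_0,v),\dots,(u_s,v)\}$ for $F=\{u_0,\dots,u_s\}\in K_1$, $v\in V(K_2)$, and $\{u\}\times F'$ for $u\in V(K_1)$, $F'\in K_2$; orientations of $K_1,K_2$ induce orientations on these faces in the obvious way. A simplicial complex is a finite set family closed under subsets; an $i$-face has $i+1$ vertices; $S_i(K)$ is the set of $i$-faces; facets are maximal faces. With an orientation (vertex orderings up to even permutations), for oriented $[\bar F]=[v_0,\dots,v_{i+1}]$ and $F=\bar F\setminus\{v_j\}$, $\operatorname{sgn}([F],\partial[\bar F])=\pm(-1)^j$ with $+$ iff the orientation of $F$ agrees with $[v_0,\dots,\hat v_j,\dots,v_{i+1}]$. Normalized weights: $w(F)=1$ for facets and $w(F)=\sum_{\bar F\in S_{i+1}(K),F\subset\bar F}w(\bar F)$ for non-facet $i$-faces. The $i$-th up normalized Laplacian $\Delta_i^{up}(K)$ acts on $f:S_i(K)\to\mathbb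 R$ by $(\Delta_i^{up}f)(F)=\sum_{\bar F\supset F}\frac{w(\bar F)}{w(F)}f(F)+\sum_{F'\ne F,\ F\cup F'=\bar F\in S_{i+1}(K)}\frac{w(\bar F)}{w(F)}\operatorname{sgn}([F],\partial[\bar F])\operatorname{sgn}([F'],\partial[\bar F])f(F')$; its spectrum is orientation independent and lies in $[0,i+2]$; $\lambda_{\max}$ is its largest eigenvalue. An $(i+1)$-path is a sequence of $(i+1)$-faces $\bar F_1,\dots,\bar F_m$ with $\bar F_j\cap\bar F_l$ an $i$-face iff $|j-l|=1$; $K$ is $(i+1)$-path connected if any two $(i+1)$-faces are joined by one. $B_i(K)$ is the bipartite signed graph on $S_i(K)\cup S_{i+1}(K)$ with edges $\{F,\bar F\}$ for $F\subset\bar F$, signed by $\operatorname{sgn}([F],\partial[\bar F])$; it is balanced if every cycle has positive sign product (independent of orientation).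
   Formalization: The formal theorem also assumes that K_1 and K_2 each have at least one (i+1)-face and, when i=0, that neither has an isolated vertex; without this the claim fails, e.g. i=0, K_1 an edge plus an isolated vertex, K_2 an edge (the product is not 1-path connected). *)

theory Defs
  imports Complex_Main "HOL-Combinatorics.Permutations"
begin

section \<open>Abstract simplicial complexes\<close>

definition simplicial_complex :: "'a set set \<Rightarrow> bool" where
  "simplicial_complex K \<longleftrightarrow> finite K \<and> (\<forall>F\<in>K. \<forall>G. G \<subseteq> F \<longrightarrow> G \<in> K)"

definition vertices :: "'a set set \<Rightarrow> 'a set" where
  "vertices K = \<Union>K"

definition faces :: "nat \<Rightarrow> 'a set set \<Rightarrow> 'a set set" where
  "faces i K = {F \<in> K. card F = i + 1}"

definition facet :: "'a set set \<Rightarrow> 'a set \<Rightarrow> bool" where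
  "facet K F \<longleftrightarrow> F \<in> K \<and> (\<forall>G\<in>K. F \<subseteq> G \<longrightarrow> G = F)"

definition cartesian_product :: "'a set set \<Rightarrow> 'b set set \<Rightarrow> ('a \<times> 'b) set set"
    (infixr "\<box>" 75) where
  "K1 \<box> K2 = {F \<times> {v} |F v. F \<in> K1 \<and> v \<in> vertices K2} \<union>
             {{u} \<times> F' |u F'. u \<in> vertices K1 \<and> F' \<in> K2}"

lemma simplicial_complex_finite_vertices:
  assumes "simplicial_complex K"
  shows "finite (vertices K)"
proof -
  have "finite F" if "F \<in> K" for F
  proof -
    have "Pow F \<subseteq> K"
      using assms that by (auto simp: simplicial_complex_def)
    then have "finite (Pow F)"
      using assms finite_subset by (auto simp: simplicial_complex_def)
    then show ?thesis by simp
  qed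
  then show ?thesis
    using assms by (auto simp: simplicial_complex_def vertices_def)
qed

lemma simplicial_complex_cartesian_product:
  assumes "simplicial_complex K1" "simplicial_complex K2"
  shows "simplicial_complex (K1 \<box> K2)"
proof -
  have fin: "finite K1" "finite K2" "finite (vertices K1)" "finite (vertices K2)"
    using assms simplicial_complex_finite_vertices by (auto simp: simplicial_complex_def)
  have "K1 \<box> K2 = (\<lambda>(F, v). F \<times> {v}) ` (K1 \<times> vertices K2) \<union>
                  (\<lambda>(u, F'). {u} \<times> F') ` (vertices K1 \<times> K2)"
    by (auto simp: cartesian_product_def)
  then have "finite (K1 \<box> K2)"
    using fin by simp
  moreover have "G \<in> K1 \<box> K2" if H: "H \<in> K1 \<box> K2" and GH: "G \<subseteq> H" for G H
  proof -
    consider F v where "H = F \<times> {v}" "F \<in> K1" "v \<in> vertices K2"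
      | u F' where "H = {u} \<times> F'" "u \<in> vertices K1" "F' \<in> K2"
      using H unfolding cartesian_product_def by blast
    then show ?thesis
    proof cases
      case 1
      have "G = fst ` G \<times> {v}" "fst ` G \<subseteq> F"
        using 1 GH by force+
      moreover from this have "fst ` G \<in> K1"
        using assms(1) 1 by (auto simp: simplicial_complex_def)
      ultimately show ?thesis
        using 1 unfolding cartesian_product_def by blast
    next
      case 2
      have "G = {u} \<times> snd ` G" "snd ` G \<subseteq> F'"
        using 2 GH by force+
      moreover from this have "snd ` G \<in> K2"
        using assms(2) 2 by (auto simp: simplicial_complex_def)
      ultimately show ?thesis
        using 2 unfolding cartesian_product_def by blast
    qed
  qed
  ultimately show ?thesis
    by (auto simp: simplicial_complex_def)
qed

section \<open>Orientations and incidence signs\<close>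

text \<open>
  An orientation of a face is a vertex ordering up to even permutations. It is represented here
  by one ordering of each face; the incidence signs below depend on that ordering only up to even
  permutations.
\<close>

definition orientation :: "'a set set \<Rightarrow> ('a set \<Rightarrow> 'a list) \<Rightarrow> bool" where
  "orientation K \<omega> \<longleftrightarrow> (\<forall>F\<in>K. distinct (\<omega> F) \<and> set (\<omega> F) = F)"

definition same_orientation :: "'a list \<Rightarrow> 'a list \<Rightarrow> bool" where
  "same_orientation xs ys \<longleftrightarrow>
     (\<exists>p. p permutes {..<length xs} \<and> evenperm p \<and> permute_list p xs = ys)"

text \<open>Only meaningful if \<open>F\<close> is a face of \<open>G\<close> with exactly one vertex less.\<close>

definition incidence_sign :: "('a set \<Rightarrow> 'a list) \<Rightarrow> 'a set \<Rightarrow> 'a set \<Rightarrow> real" where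
  "incidence_sign \<omega> F G =
     (let j = (THE j. j < length (\<omega> G) \<and> F = G - {\<omega> G ! j})
      in (if same_orientation (\<omega> F) (take j (\<omega> G) @ drop (Suc j) (\<omega> G)) then 1 else - 1)
           * (- 1) ^ j)"

section \<open>Weights and the up normalized Laplacian\<close>

text \<open>The outermost condition only ensures termination; faces of complexes always satisfy it.\<close>

function weight :: "'a set set \<Rightarrow> 'a set \<Rightarrow> real" where
  "weight K F =
     (if \<not> (simplicial_complex K \<and> F \<in> K) then 0
      else if facet K F then 1
      else (\<Sum>G\<in>{G \<in> K. F \<subset> G \<and> card G = card F + 1}. weight K G))"
  by pat_completeness auto
termination
proof (relation "measure (\<lambda>(K, F). card (vertices K) - card F)", goal_cases)
  case 1
  show ?case by simp
next
  case (2 K F G)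
  then have "finite (vertices K)" "G \<subseteq> vertices K" "card G = card F + 1"
    using simplicial_complex_finite_vertices by (auto simp: vertices_def)
  then have "card F < card (vertices K)"
    using card_mono[of "vertices K" G] by simp
  with \<open>card G = card F + 1\<close> show ?case by simp
qed

declare weight.simps [simp del]

definition up_laplacian ::
  "'a set set \<Rightarrow> ('a set \<Rightarrow> 'a list) \<Rightarrow> nat \<Rightarrow> ('a set \<Rightarrow> real) \<Rightarrow> 'a set \<Rightarrow> real" where
  "up_laplacian K \<omega> i f F =
     (\<Sum>G\<in>{G \<in> faces (i + 1) K. F \<subset> G}. weight K G / weight K F * f F) +
     (\<Sum>F'\<in>{F' \<in> faces i K. F' \<noteq> F \<and> F \<union> F' \<in> faces (i + 1) K}.
        weight K (F \<union> F') / weight K F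
          * incidence_sign \<omega> F (F \<union> F') * incidence_sign \<omega> F' (F \<union> F') * f F')"

text \<open>
  Functions on \<open>faces i K\<close> are represented by total functions whose values elsewhere are
  irrelevant, so an eigenfunction has to be nonzero at some \<open>i\<close>-face.
\<close>

definition up_spectrum :: "'a set set \<Rightarrow> ('a set \<Rightarrow> 'a list) \<Rightarrow> nat \<Rightarrow> real set" where
  "up_spectrum K \<omega> i =
     {\<mu>. \<exists>f. (\<exists>F\<in>faces i K. f F \<noteq> 0) \<and> (\<forall>F\<in>faces i K. up_laplacian K \<omega> i f F = \<mu> * f F)}"

definition lambda_max :: "'a set set \<Rightarrow> ('a set \<Rightarrow> 'a list) \<Rightarrow> nat \<Rightarrow> real" where
  "lambda_max K \<omega> i = Max (up_spectrum K \<omega> i)"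

section \<open>Paths of faces\<close>

text \<open>Paths of \<open>d\<close>-faces meeting in \<open>(d - 1)\<close>-faces; only used for \<open>d \<ge> 1\<close>.\<close>

definition face_path :: "nat \<Rightarrow> 'a set set \<Rightarrow> 'a set list \<Rightarrow> bool" where
  "face_path d K Fs \<longleftrightarrow> Fs \<noteq> [] \<and> set Fs \<subseteq> faces d K \<and>
     (\<forall>j<length Fs. \<forall>l<length Fs.
        Fs ! j \<inter> Fs ! l \<in> faces (d - 1) K \<longleftrightarrow> \<bar>int j - int l\<bar> = 1)"

definition face_path_connected :: "nat \<Rightarrow> 'a set set \<Rightarrow> bool" where
  "face_path_connected d K \<longleftrightarrow>
     (\<forall>F\<in>faces d K. \<forall>F'\<in>faces d K. \<exists>Fs. face_path d K Fs \<and> hd Fs = F \<and> last Fs = F')"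

section \<open>Signed graphs and the incidence graph\<close>

record 'v signed_graph =
  sg_verts :: "'v set"
  sg_edges :: "'v set set"
  sg_sign :: "'v set \<Rightarrow> real"

definition sg_cycle :: "'v signed_graph \<Rightarrow> 'v list \<Rightarrow> bool" where
  "sg_cycle G vs \<longleftrightarrow> length vs \<ge> 3 \<and> distinct vs \<and> set vs \<subseteq> sg_verts G \<and>
     (\<forall>k<length vs. {vs ! k, vs ! (Suc k mod length vs)} \<in> sg_edges G)"

definition balanced :: "'v signed_graph \<Rightarrow> bool" where
  "balanced G \<longleftrightarrow>
     (\<forall>vs. sg_cycle G vs \<longrightarrow>
        (\<Prod>k<length vs. sg_sign G {vs ! k, vs ! (Suc k mod length vs)}) > 0)"

text \<open>
  For an edge \<open>e = {F, G}\<close> with \<open>F \<subset> G\<close> one has \<open>\<Inter>e = F\<close> and \<open>\<Union>e = G\<close>, so the sign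
  of \<open>e\<close> is the sign of \<open>F\<close> in the boundary of \<open>G\<close>.
\<close>

definition incidence_graph ::
  "'a set set \<Rightarrow> ('a set \<Rightarrow> 'a list) \<Rightarrow> nat \<Rightarrow> 'a set signed_graph" where
  "incidence_graph K \<omega> i =
     \<lparr>sg_verts = faces i K \<union> faces (i + 1) K,
      sg_edges = {{F, G} |F G. F \<in> faces i K \<and> G \<in> faces (i + 1) K \<and> F \<subset> G},
      sg_sign = (\<lambda>e. incidence_sign \<omega> (\<Inter>e) (\<Union>e))\<rparr>"

end

theory Submission
  imports Defs "Jordan_Normal_Form.Spectral_Radius"
begin

text \<open>
  Pairing \<open>\<Delta> f\<close> with \<open>f\<close> gives \<open>\<Sum>\<^sub>G w(G) (\<Sum>\<^sub>F sgn(F, G) f(F))\<^sup>2\<close>, so by Cauchy--Schwarz every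
  eigenvalue is at most \<open>i + 2\<close>, with equality iff there is a nontrivial \<open>f\<close> for which
  \<open>sgn(F, G) f(F)\<close> is constant on the boundary of each \<open>(i + 1)\<close>-face \<open>G\<close> (a coherent function). On a
  path connected complex such an \<open>f\<close> vanishes on no \<open>i\<close>-face of an \<open>(i + 1)\<close>-face, so its signs are a
  potential for the incidence graph and, by Harary's theorem, coherence means balance.
  Coherent functions of a product restrict to its layers. For \<open>i \<ge> 1\<close> the horizontal and vertical
  layers share no \<open>i\<close>-face, so a coherent function on one layer extends by zero; for \<open>i = 0\<close>
  coherent functions of the factors multiply.
\<close>

section \<open>Ordered faces and incidence signs\<close>

text \<open>The product carries an arbitrary orientation \<open>\<omega>\<close>, unrelated to
  \<open>\<omega>1\<close> and \<open>\<omega>2\<close>, so its incidence signs cannot be compared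
  with those of the factors directly. All three sign functions are therefore switched to signs of a
  vertex order: replacing an orientation by increasing order under an injection \<open>g\<close>
  multiplies the sign of \<open>F\<close> in \<open>G\<close> by one factor depending on
  \<open>F\<close> and one depending on \<open>G\<close>, which does not affect the existence of
  coherent functions. For a lexicographic order on the product, the signs inside a layer are
  literally those of a factor. Since \<open>lambda_max\<close> is a \<open>Max\<close>, finiteness
  and nonemptiness of the spectrum have to be known as well; the Laplacian is not symmetric, but
  becomes so when each row is multiplied by its weight. Without \<open>(i + 1)\<close>-faces an
  incidence graph is vacuously balanced although no coherent function exists. For
  \<open>i = 0\<close>, an isolated vertex \<open>u\<close> of \<open>K1\<close> would cut the
  vertical layer over \<open>u\<close> off from the other edges: connectedness would fail, and that
  layer alone could attain 2 with an unbalanced \<open>K1\<close>.\<close>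

text \<open>There is one factor per pair of positions, so for \<open>g\<close> injective on a list
  without repetitions this is the sign of the permutation sorting it by \<open>g\<close>. Real
  values of \<open>g\<close> turn the parity of inversions into a product of \<open>sgn\<close>
  terms.\<close>

primrec list_sign :: "('a \<Rightarrow> real) \<Rightarrow> 'a list \<Rightarrow> real" where
  "list_sign g [] = 1"
| "list_sign g (x # xs) = (\<Prod>y\<in>set xs. sgn (g y - g x)) * list_sign g xs"

lemma list_sign_append:
  assumes "distinct (xs @ ys)"
  shows "list_sign g (xs @ ys) =
    list_sign g xs * list_sign g ys * (\<Prod>x\<in>set xs. \<Prod>y\<in>set ys. sgn (g y - g x))"
  using assms
proof (induction xs)
  case (Cons x xs)
  then have "(\<Prod>y\<in>set xs \<union> set ys. sgn (g y - g x)) =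
      (\<Prod>y\<in>set xs. sgn (g y - g x)) * (\<Prod>y\<in>set ys. sgn (g y - g x))"
    by (intro prod.union_disjoint) auto
  with Cons show ?case by simp
qed simp

text \<open>Every element between \<open>x\<close> and \<open>y\<close> changes its order relative
  to both of them, and these two changes cancel; outer elements keep their order. What remains is
  the reversed pair of \<open>x\<close> and \<open>y\<close>.\<close>

lemma list_sign_swap:
  assumes "distinct (as @ x # bs @ y # cs)"
  shows "list_sign g (as @ y # bs @ x # cs) = - list_sign g (as @ x # bs @ y # cs)"
proof -
  have flip: "sgn (a - b) = - sgn (b - a)" for a b :: real
    by (metis minus_diff_eq sgn_minus)
  have eq: "(\<Prod>b\<in>set bs. sgn (g b - g y)) * (\<Prod>b\<in>set bs. sgn (g x - g b)) =
      (\<Prod>b\<in>set bs. sgn (g b - g x)) * (\<Prod>b\<in>set bs. sgn (g y - g b))"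
    unfolding prod.distrib[symmetric]
    by (intro prod.cong refl) (metis flip minus_mult_minus mult.commute)
  have "list_sign g (y # bs @ x # cs) = - list_sign g (x # bs @ y # cs)"
  proof -
    have D: "distinct (bs @ x # cs)" "distinct (bs @ y # cs)" using assms by auto
    have 1: "(\<Prod>z\<in>set (bs @ x # cs). sgn (g z - g y)) =
        (\<Prod>b\<in>set bs. sgn (g b - g y)) * (sgn (g x - g y) * (\<Prod>c\<in>set cs. sgn (g c - g y)))"
      using D by (simp add: prod.union_disjoint)
    have 2: "(\<Prod>z\<in>set (bs @ y # cs). sgn (g z - g x)) =
        (\<Prod>b\<in>set bs. sgn (g b - g x)) * (sgn (g y - g x) * (\<Prod>c\<in>set cs. sgn (g c - g x)))"
      using D by (simp add: prod.union_disjoint)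
    have 3: "(\<Prod>b\<in>set bs. \<Prod>z\<in>set (v # cs). sgn (g z - g b)) =
        (\<Prod>b\<in>set bs. sgn (g v - g b)) * (\<Prod>b\<in>set bs. \<Prod>z\<in>set cs. sgn (g z - g b))"
      if "v \<notin> set cs" for v
      using that by (simp add: prod.distrib)
    have 4: "x \<notin> set cs" "y \<notin> set cs" using D by auto
    show ?thesis
      unfolding list_sign.simps(2) 1 2 list_sign_append[OF D(1)] list_sign_append[OF D(2)]
        3[OF 4(1)] 3[OF 4(2)]
      using eq flip[of "g x" "g y"] by (simp add: algebra_simps)
  qed
  moreover have "(\<Prod>a\<in>set as. \<Prod>z\<in>set (y # bs @ x # cs). sgn (g z - g a)) =
     (\<Prod>a\<in>set as. \<Prod>z\<in>set (x # bs @ y # cs). sgn (g z - g a))"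
    by (intro prod.cong refl) auto
  moreover have "distinct (as @ y # bs @ x # cs)" using assms by auto
  ultimately show ?thesis
    using assms by (simp only: list_sign_append)
qed

lemma list_sign_transpose:
  assumes "distinct xs" "a < length xs" "b < length xs" "a \<noteq> b"
  shows "list_sign g (permute_list (transpose a b) xs) = - list_sign g xs"
proof -
  have *: "list_sign g (permute_list (transpose a b) xs) = - list_sign g xs"
    if "a < b" "b < length xs" for a b
  proof -
    define as bs cs where "as = take a xs" and "bs = take (b - Suc a) (drop (Suc a) xs)"
      and "cs = drop (Suc b) xs"
    have "drop (Suc a) xs = bs @ xs ! b # cs"
      using that id_take_nth_drop[of "b - Suc a" "drop (Suc a) xs"]
      by (simp add: bs_def cs_def)
    then have xs: "xs = as @ xs ! a # bs @ xs ! b # cs"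
      using that id_take_nth_drop[of a xs] by (simp add: as_def)
    have len: "length as = a" "length bs = b - Suc a" using that by (auto simp: as_def bs_def)
    have len': "length xs = Suc (b + length cs)" using that by (auto simp: cs_def)
    have "permute_list (transpose a b) xs = as @ xs ! b # bs @ xs ! a # cs"
    proof (rule nth_equalityI)
      fix k assume "k < length (permute_list (transpose a b) xs)"
      then have k: "k < length xs" by simp
      have "permute_list (transpose a b) xs ! k = xs ! transpose a b k"
        using k that by (intro permute_list_nth permutes_swap_id) auto
      also have "\<dots> = (as @ xs ! b # bs @ xs ! a # cs) ! k"
      proof (cases "k = a \<or> k = b")
        case True
        then show ?thesis using that len by (auto simp: nth_append)
      next
        case False
        then have "transpose a b k = k" by simp
        moreover have "(as @ u # bs @ v # cs) ! k = (as @ u' # bs @ v' # cs) ! k" for u v u' v'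
          using False that len by (auto simp: nth_append nth_Cons split: nat.split)
        ultimately show ?thesis using xs by metis
      qed
      finally show "permute_list (transpose a b) xs ! k = (as @ xs ! b # bs @ xs ! a # cs) ! k" .
    qed (use len len' that in auto)
    moreover have "distinct (as @ xs ! a # bs @ xs ! b # cs)"
      using assms(1) xs by simp
    ultimately show ?thesis
      using list_sign_swap xs by metis
  qed
  show ?thesis
  proof (cases "a < b")
    case False
    with assms(4) have "b < a" by simp
    from *[OF this assms(2)] show ?thesis by (simp add: transpose_commute)
  qed (use * assms in blast)
qed

text \<open>Induction over a decomposition into transpositions. In
  \<open>permute_list (transpose a b \<circ> p) xs\<close> the transposition acts on the list before
  \<open>p\<close> does, so the induction hypothesis is needed for a rearranged list:
  \<open>xs\<close> stays arbitrary and just its length \<open>n\<close> is fixed.\<close>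

lemma list_sign_permute_list:
  assumes "p permutes {..<length xs}" "distinct xs"
  shows "list_sign g (permute_list p xs) = of_int (sign p) * list_sign g xs"
proof -
  have "list_sign g (permute_list p xs) = of_int (sign p) * list_sign g xs"
    if "p permutes {..<n}" "distinct xs" "length xs = n" for n xs
    using that(1) finite_lessThan that(2,3)
  proof (induction arbitrary: xs rule: permutes_induct)
    case id
    then show ?case by simp
  next
    case (swap a b p)
    then have tr: "transpose a b permutes {..<length xs}"
      by (intro permutes_swap_id) auto
    have perm: "permutation p" "permutation (transpose a b)"
      using swap tr by (auto simp: permutation_swap_id intro: permutes_imp_permutation)
    have "list_sign g (permute_list (transpose a b \<circ> p) xs) =
        list_sign g (permute_list p (permute_list (transpose a b) xs))"
      using swap by (subst permute_list_compose) auto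
    also have "\<dots> = of_int (sign p) * list_sign g (permute_list (transpose a b) xs)"
      using swap tr by (intro swap.IH) auto
    also have "\<dots> = of_int (sign (transpose a b \<circ> p)) * list_sign g xs"
      using swap by (simp add: list_sign_transpose sign_compose perm sign_swap_id)
    finally show ?case .
  qed
  with assms show ?thesis by blast
qed

lemma list_sign_cases:
  assumes "distinct xs" "inj_on g (set xs)"
  shows "list_sign g xs = 1 \<or> list_sign g xs = - 1"
  using assms
proof (induction xs)
  case (Cons x xs)
  then have "\<bar>\<Prod>y\<in>set xs. sgn (g y - g x)\<bar> = 1"
    unfolding abs_prod by (intro prod.neutral) (auto simp: abs_sgn_eq inj_on_def)
  with Cons show ?case by (auto simp: abs_if split: if_splits)
qed simp

text \<open>For injective \<open>g\<close> the sign is nonzero, so it detects the parity of any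
  permutation carrying \<open>xs\<close> to \<open>ys\<close>; one exists because both lists
  enumerate the same set without repetition.\<close>

lemma same_orientation_iff_list_sign:
  assumes "distinct xs" "distinct ys" "set xs = set ys" "inj_on g (set xs)"
  shows "same_orientation xs ys \<longleftrightarrow> list_sign g xs = list_sign g ys"
proof
  assume "same_orientation xs ys"
  then show "list_sign g xs = list_sign g ys"
    using assms list_sign_permute_list[of _ xs g]
    by (auto simp: same_orientation_def sign_def)
next
  assume eq: "list_sign g xs = list_sign g ys"
  have "mset ys = mset xs"
    using assms by (simp add: set_eq_iff_mset_eq_distinct)
  then obtain p where p: "p permutes {..<length xs}" "permute_list p xs = ys"
    by (rule mset_eq_permutation)
  have "evenperm p"
    using list_sign_permute_list[OF p(1) assms(1), of g] p(2) eq list_sign_cases[OF assms(1,4)]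
    by (auto simp: sign_def split: if_splits)
  with p show "same_orientation xs ys"
    by (auto simp: same_orientation_def)
qed

text \<open>The incidence sign when all faces are oriented by increasing \<open>g\<close>; an arbitrary orientation
  changes it only by switching with \<open>list_sign g (\<omega> F)\<close>.\<close>

definition order_sign :: "('a \<Rightarrow> real) \<Rightarrow> 'a set \<Rightarrow> 'a set \<Rightarrow> real" where
  "order_sign g F G = (\<Prod>x\<in>G - F. \<Prod>y\<in>F. sgn (g y - g x))"

lemma incidence_sign_cases: "incidence_sign \<omega> F G = 1 \<or> incidence_sign \<omega> F G = - 1"
  by (simp add: incidence_sign_def Let_def minus_one_power_iff)

lemma incidence_sign_square [simp]: "incidence_sign \<omega> F G * incidence_sign \<omega> F G = 1"
  using incidence_sign_cases[of \<omega> F G] by auto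

text \<open>With \<open>\<omega> G = as @ x # bs\<close> and \<open>x\<close> the missing vertex,
  \<open>order_sign\<close> compares as if \<open>x\<close> came first. The vertices of
  \<open>as\<close> precede it instead, and reversing these pairs costs exactly the
  \<open>(- 1) ^ j\<close> of the boundary formula. The remaining factor compares
  \<open>\<omega> F\<close> with \<open>as @ bs\<close>, which is what
  \<open>same_orientation\<close> tests.\<close>

lemma incidence_sign_eq_order_sign:
  assumes "distinct (\<omega> F)" "set (\<omega> F) = F" "distinct (\<omega> G)" "set (\<omega> G) = G"
    and "F \<subseteq> G" "card G = card F + 1" "inj_on g G"
  shows "incidence_sign \<omega> F G =
    list_sign g (\<omega> F) * list_sign g (\<omega> G) * order_sign g F G"
proof -
  have fin: "finite F" "finite G" using assms(2,4) by (metis List.finite_set)+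
  then have "card (G - F) = 1"
    using assms by (simp add: card_Diff_subset)
  then obtain x where x: "G - F = {x}" by (auto simp: card_1_singleton_iff)
  then have "x \<in> set (\<omega> G)" using assms by auto
  then obtain as bs where asbs: "\<omega> G = as @ x # bs" by (meson split_list)
  have F: "F = set as \<union> set bs" and "x \<notin> F" and D: "distinct (as @ x # bs)"
    using x assms(3,4,5) asbs by auto
  have j: "(THE j. j < length (\<omega> G) \<and> F = G - {\<omega> G ! j}) = length as"
  proof (rule the_equality)
    show "length as < length (\<omega> G) \<and> F = G - {\<omega> G ! length as}"
      using asbs x assms(5) by auto
    fix j assume j: "j < length (\<omega> G) \<and> F = G - {\<omega> G ! j}"
    then have "\<omega> G ! j \<in> G" using assms(4) nth_mem by blast
    then have "\<omega> G ! j = x" using j x by blast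
    then have "\<omega> G ! j = \<omega> G ! length as" by (simp add: asbs)
    moreover have "length as < length (\<omega> G)" by (simp add: asbs)
    ultimately show "j = length as"
      using assms(3) j nth_eq_iff_index_eq by blast
  qed
  have flip: "(\<Prod>a\<in>set as. sgn (g x - g a)) = (- 1) ^ length as * (\<Prod>a\<in>set as. sgn (g a - g x))"
  proof -
    have "(\<Prod>a\<in>set as. sgn (g x - g a)) = (\<Prod>a\<in>set as. (- 1) * sgn (g a - g x))"
      by (intro prod.cong refl) (metis minus_diff_eq mult_minus1 sgn_minus)
    also have "\<dots> = (- 1) ^ length as * (\<Prod>a\<in>set as. sgn (g a - g x))"
      using D by (simp only: prod.distrib) (simp add: distinct_card)
    finally show ?thesis .
  qed
  have "list_sign g (\<omega> G) = list_sign g as * ((\<Prod>y\<in>set bs. sgn (g y - g x)) * list_sign g bs) *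
      ((\<Prod>a\<in>set as. sgn (g x - g a)) * (\<Prod>a\<in>set as. \<Prod>y\<in>set bs. sgn (g y - g a)))"
    unfolding asbs list_sign_append[OF D] using D by (simp add: prod.distrib)
  moreover have "list_sign g (as @ bs) = list_sign g as * list_sign g bs *
     (\<Prod>a\<in>set as. \<Prod>y\<in>set bs. sgn (g y - g a))"
    using D by (intro list_sign_append) auto
  moreover have os: "order_sign g F G = (\<Prod>y\<in>set as. sgn (g y - g x)) * (\<Prod>y\<in>set bs. sgn (g y - g x))"
    unfolding order_sign_def x using D by (simp add: F prod.union_disjoint)
  ultimately have eq: "list_sign g (\<omega> G) = (- 1) ^ length as * order_sign g F G * list_sign g (as @ bs)"
    by (simp add: flip)
  have gne: "g y \<noteq> g x" if "y \<in> F" for y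
    using inj_onD[OF assms(7), of y x] that x assms(5) by blast
  have "\<bar>order_sign g F G\<bar> = 1"
    unfolding order_sign_def x abs_prod using gne by (auto simp: abs_sgn_eq intro!: prod.neutral)
  then have os1: "order_sign g F G * order_sign g F G = 1"
    by (auto simp: abs_if split: if_splits)
  have "(- 1) ^ length as * list_sign g (as @ bs) = list_sign g (\<omega> G) * order_sign g F G"
    using os1 by (simp add: eq)
  moreover have "list_sign g (as @ bs) = 1 \<or> list_sign g (as @ bs) = - 1"
    using D F assms(5,7) by (intro list_sign_cases) (auto intro: inj_on_subset)
  moreover have "list_sign g (\<omega> F) = 1 \<or> list_sign g (\<omega> F) = - 1"
    using assms by (intro list_sign_cases) (auto intro: inj_on_subset)
  moreover have "same_orientation (\<omega> F) (as @ bs) \<longleftrightarrow> list_sign g (\<omega> F) = list_sign g (as @ bs)"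
    using assms D F by (intro same_orientation_iff_list_sign) (auto intro: inj_on_subset)
  ultimately show ?thesis
    unfolding incidence_sign_def j Let_def by (auto simp: asbs mult.assoc)
qed

section \<open>Spectra of symmetrizable operators\<close>

text \<open>Finiteness is inherited from the spectrum of the complex matrix \<open>A\<close>, which
  is also nonempty. As \<open>a\<close> is self-adjoint for the inner product weighted by
  \<open>w\<close>, a complex eigenvalue is real, and the real or imaginary part of its eigenvector
  is a real eigenfunction.\<close>

lemma finite_nonempty_symmetrizable_spectrum:
  fixes a :: "'a \<Rightarrow> 'a \<Rightarrow> real" and w :: "'a \<Rightarrow> real"
  assumes fin: "finite S" and ne: "S \<noteq> {}" and pos: "\<And>x. x \<in> S \<Longrightarrow> w x > 0"
    and sym: "\<And>x y. x \<in> S \<Longrightarrow> y \<in> S \<Longrightarrow> w x * a x y = w y * a y x"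
  defines "Sp \<equiv> {\<mu>. \<exists>f. (\<exists>x\<in>S. f x \<noteq> 0) \<and> (\<forall>x\<in>S. (\<Sum>y\<in>S. a x y * f y) = \<mu> * f x)}"
  shows "finite Sp" and "Sp \<noteq> {}"
proof -
  define n where "n = card S"
  obtain h where h: "bij_betw h {0..<n} S"
    using ex_bij_betw_nat_finite[OF fin] n_def by auto
  define A where "A = mat n n (\<lambda>(i, j). complex_of_real (a (h i) (h j)))"
  have A: "A \<in> carrier_mat n n" by (simp add: A_def)
  have spec: "\<mu> \<in> spectrum A \<longleftrightarrow>
      (\<exists>f. (\<exists>x\<in>S. f x \<noteq> 0) \<and> (\<forall>x\<in>S. (\<Sum>y\<in>S. complex_of_real (a x y) * f y) = \<mu> * f x))" for \<mu>
  proof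
    assume "\<mu> \<in> spectrum A"
    then obtain v where v: "v \<in> carrier_vec n" "v \<noteq> 0\<^sub>v n" "A *\<^sub>v v = \<mu> \<cdot>\<^sub>v v"
      using A by (auto simp: spectrum_def eigenvalue_def eigenvector_def)
    define f where "f x = v $ the_inv_into {0..<n} h x" for x
    have fh: "f (h i) = v $ i" if "i < n" for i
      using that h by (simp add: f_def the_inv_into_f_f bij_betw_def)
    obtain i where i: "i < n" "v $ i \<noteq> 0"
      using v(1,2) by (metis carrier_vecD eq_vecI index_zero_vec)
    have "(\<Sum>y\<in>S. complex_of_real (a x y) * f y) = \<mu> * f x" if "x \<in> S" for x
    proof -
      from that h obtain k where k: "k < n" "x = h k"
        by (metis atLeastLessThan_iff bij_betw_iff_bijections)
      have "(\<Sum>y\<in>S. complex_of_real (a x y) * f y) = (\<Sum>j\<in>{0..<n}. complex_of_real (a x (h j)) * f (h j))"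
        by (rule sum.reindex_bij_betw[OF h, symmetric])
      also have "\<dots> = (\<Sum>j\<in>{0..<n}. A $$ (k, j) * v $ j)"
        using k by (intro sum.cong) (auto simp: A_def fh)
      also have "\<dots> = (A *\<^sub>v v) $ k"
        using k A v(1) by (auto simp: scalar_prod_def intro!: sum.cong)
      also have "\<dots> = \<mu> * f x" using v k by (simp add: fh)
      finally show ?thesis .
    qed
    moreover have "h i \<in> S" "f (h i) \<noteq> 0"
      using i fh h by (auto simp: bij_betw_def)
    ultimately show "\<exists>f. (\<exists>x\<in>S. f x \<noteq> 0) \<and> (\<forall>x\<in>S. (\<Sum>y\<in>S. complex_of_real (a x y) * f y) = \<mu> * f x)"
      by blast
  next
    assume "\<exists>f. (\<exists>x\<in>S. f x \<noteq> 0) \<and> (\<forall>x\<in>S. (\<Sum>y\<in>S. complex_of_real (a x y) * f y) = \<mu> * f x)"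
    then obtain f x0 where f: "x0 \<in> S" "f x0 \<noteq> 0"
      and ev: "\<And>x. x \<in> S \<Longrightarrow> (\<Sum>y\<in>S. complex_of_real (a x y) * f y) = \<mu> * f x" by blast
    from f(1) h obtain k where k: "k < n" "x0 = h k"
      by (metis atLeastLessThan_iff bij_betw_iff_bijections)
    define v where "v = vec n (\<lambda>i. f (h i))"
    have "v $ k \<noteq> 0\<^sub>v n $ k" using k f by (simp add: v_def)
    then have "v \<noteq> 0\<^sub>v n" by auto
    moreover have "A *\<^sub>v v = \<mu> \<cdot>\<^sub>v v"
    proof (rule eq_vecI)
      fix i assume "i < dim_vec (\<mu> \<cdot>\<^sub>v v)"
      then have i: "i < n" by (simp add: v_def)
      then have "h i \<in> S" using h by (auto simp: bij_betw_def)
      have "(A *\<^sub>v v) $ i = (\<Sum>j\<in>{0..<n}. complex_of_real (a (h i) (h j)) * f (h j))"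
        using i by (auto simp: A_def v_def scalar_prod_def intro!: sum.cong)
      also have "\<dots> = (\<Sum>y\<in>S. complex_of_real (a (h i) y) * f y)"
        by (rule sum.reindex_bij_betw[OF h])
      also have "\<dots> = \<mu> * f (h i)" by (rule ev) fact
      finally show "(A *\<^sub>v v) $ i = (\<mu> \<cdot>\<^sub>v v) $ i" using i by (simp add: v_def)
    qed (auto simp: A_def v_def)
    ultimately show "\<mu> \<in> spectrum A"
      using A by (auto simp: spectrum_def eigenvalue_def eigenvector_def v_def intro!: exI[of _ v])
  qed
  have "of_real \<mu> \<in> spectrum A" if "\<mu> \<in> Sp" for \<mu>
  proof -
    from that obtain f where "\<exists>x\<in>S. f x \<noteq> 0" "\<forall>x\<in>S. (\<Sum>y\<in>S. a x y * f y) = \<mu> * f x"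
      unfolding Sp_def by blast
    then have "\<exists>x\<in>S. complex_of_real (f x) \<noteq> 0"
      "\<forall>x\<in>S. (\<Sum>y\<in>S. complex_of_real (a x y) * complex_of_real (f y)) = of_real \<mu> * complex_of_real (f x)"
      by (simp_all flip: of_real_mult of_real_sum)
    then show ?thesis unfolding spec by (intro exI[of _ "\<lambda>x. complex_of_real (f x)"]) blast
  qed
  then have "Sp \<subseteq> Re ` spectrum A" by force
  then show "finite Sp"
    using card_finite_spectrum(1)[OF A] finite_surj by blast
  have "n \<noteq> 0" using ne fin by (simp add: n_def)
  then obtain \<mu> where "\<mu> \<in> spectrum A" using spectrum_non_empty[OF A] by blast
  then obtain f x0 where f: "x0 \<in> S" "f x0 \<noteq> 0"
    and ev: "\<And>x. x \<in> S \<Longrightarrow> (\<Sum>y\<in>S. complex_of_real (a x y) * f y) = \<mu> * f x"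
    unfolding spec by blast
  \<comment> \<open>\<open>E\<close> is the weighted inner product of \<open>f\<close> with its
    image and \<open>N\<close> the squared norm of \<open>f\<close>: the eigenvalue equation gives
    \<open>E = \<mu> * N\<close>, and symmetry makes \<open>E\<close> real.\<close>
  define E where "E = (\<Sum>x\<in>S. \<Sum>y\<in>S. complex_of_real (w x * a x y) * cnj (f x) * f y)"
  define N where "N = (\<Sum>x\<in>S. w x * (cmod (f x))\<^sup>2)"
  have "E = (\<Sum>x\<in>S. of_real (w x) * cnj (f x) * (\<Sum>y\<in>S. complex_of_real (a x y) * f y))"
    by (simp add: E_def sum_distrib_left algebra_simps)
  also have "\<dots> = (\<Sum>x\<in>S. of_real (w x) * cnj (f x) * (\<mu> * f x))"
    by (intro sum.cong refl) (simp add: ev)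
  also have "\<dots> = \<mu> * of_real N"
    by (simp add: N_def sum_distrib_left complex_norm_square algebra_simps del: of_real_power)
  finally have "E = \<mu> * of_real N" .
  moreover have "cnj E = E"
  proof -
    have "cnj E = (\<Sum>x\<in>S. \<Sum>y\<in>S. complex_of_real (w y * a y x) * cnj (f y) * f x)"
      unfolding E_def cnj_sum by (intro sum.cong refl) (simp add: sym)
    also have "\<dots> = E" unfolding E_def by (rule sum.swap)
    finally show ?thesis .
  qed
  moreover have "N > 0"
    unfolding N_def using f pos fin by (intro sum_pos2[of S x0]) (auto simp: less_imp_le)
  ultimately have "cnj \<mu> * of_real N = \<mu> * of_real N" "of_real N \<noteq> (0 :: complex)"
    using complex_cnj_mult[of \<mu> "of_real N"] by auto
  then have "cnj \<mu> = \<mu>" by simp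
  then have "Im \<mu> = 0" by (simp add: complex_eq_iff)
  \<comment> \<open>With real coefficients and a real eigenvalue the equation splits into real and
    imaginary parts; whichever part is nonzero at \<open>x0\<close> serves as eigenfunction.\<close>
  then have ev': "(\<Sum>y\<in>S. a x y * Re (f y)) = Re \<mu> * Re (f x)"
    "(\<Sum>y\<in>S. a x y * Im (f y)) = Re \<mu> * Im (f x)" if "x \<in> S" for x
    using arg_cong[OF ev[OF that], of Re] arg_cong[OF ev[OF that], of Im] by simp_all
  have "Re (f x0) \<noteq> 0 \<or> Im (f x0) \<noteq> 0" using f by (auto simp: complex_eq_iff)
  then have "Re \<mu> \<in> Sp"
  proof
    assume "Re (f x0) \<noteq> 0"
    with ev' f(1) show ?thesis
      unfolding Sp_def by (intro CollectI exI[of _ "\<lambda>x. Re (f x)"]) blast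
  next
    assume "Im (f x0) \<noteq> 0"
    with ev' f(1) show ?thesis
      unfolding Sp_def by (intro CollectI exI[of _ "\<lambda>x. Im (f x)"]) blast
  qed
  then show "Sp \<noteq> {}" by blast
qed

section \<open>The top of the spectrum\<close>

text \<open>Such an \<open>f\<close>, cut off to \<open>0\<close> on facets, is exactly an eigenfunction for the eigenvalue \<open>i + 2\<close>.\<close>

definition coherent :: "'a set set \<Rightarrow> ('a set \<Rightarrow> 'a set \<Rightarrow> real) \<Rightarrow> nat \<Rightarrow> ('a set \<Rightarrow> real) \<Rightarrow> bool" where
  "coherent K s i f \<longleftrightarrow>
     (\<forall>G\<in>faces (i + 1) K. \<exists>c. \<forall>F\<in>faces i K. F \<subset> G \<longrightarrow> s F G * f F = c) \<and>
     (\<exists>G\<in>faces (i + 1) K. \<exists>F\<in>faces i K. F \<subset> G \<and> f F \<noteq> 0)"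

lemma faces_finite: "simplicial_complex K \<Longrightarrow> finite (faces i K)"
  by (auto simp: simplicial_complex_def faces_def)

lemma finite_mem_faces: "F \<in> faces i K \<Longrightarrow> finite F"
  by (auto simp: faces_def intro: card_ge_0_finite)

text \<open>This count is the origin of the constant \<open>i + 2\<close>: it is the number of terms
  to which Cauchy--Schwarz is applied.\<close>

lemma card_subfaces:
  assumes "simplicial_complex K" "G \<in> faces (i + 1) K"
  shows "card {F \<in> faces i K. F \<subset> G} = i + 2"
proof -
  have "{F \<in> faces i K. F \<subset> G} = {F. F \<subseteq> G \<and> card F = i + 1}"
    using assms by (auto simp: faces_def simplicial_complex_def)
  then show ?thesis
    using n_subsets[OF finite_mem_faces[OF assms(2)], of "i + 1"] assms(2)
    by (simp add: faces_def)
qed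

text \<open>Two distinct \<open>i\<close>-faces have at most one common coface of dimension
  \<open>i + 1\<close>. Hence pairs \<open>(G, F')\<close> with \<open>F\<close> and
  \<open>F'\<close> in the boundary of \<open>G\<close> can be indexed by \<open>F'\<close> alone,
  as the definition of the Laplacian does.\<close>

lemma union_of_two_subfaces:
  assumes "F \<in> faces i K" "F' \<in> faces i K" "G \<in> faces (i + 1) K" "F \<subset> G" "F' \<subset> G" "F' \<noteq> F"
  shows "F \<union> F' = G"
proof -
  have fin: "finite F" "finite F'" "finite G" using assms finite_mem_faces by blast+
  have "F \<subset> F \<union> F'"
    using assms fin card_subset_eq[of F F'] by (auto simp: faces_def)
  then have "card F < card (F \<union> F')" using fin by (intro psubset_card_mono) auto
  then show ?thesis
    using assms fin card_mono[of G "F \<union> F'"] by (intro card_subset_eq) (auto simp: faces_def)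
qed

lemma coface_of_non_facet:
  assumes "simplicial_complex K" "F \<in> K" "finite F" "\<not> facet K F"
  shows "\<exists>G\<in>K. F \<subset> G \<and> card G = card F + 1"
proof -
  from assms obtain G x where "G \<in> K" "F \<subseteq> G" "x \<in> G" "x \<notin> F"
    unfolding facet_def by blast
  with assms show ?thesis
    by (intro bexI[of _ "insert x F"]) (auto simp: simplicial_complex_def)
qed

lemma finite_face:
  assumes "simplicial_complex K" "F \<in> K"
  shows "finite F"
  using simplicial_complex_finite_vertices[OF assms(1)] assms(2)
  by (auto simp: vertices_def intro: finite_subset)

text \<open>A non-facet has a coface with exactly one more vertex, so the recursive sum is never
  empty.\<close>

lemma weight_pos: "simplicial_complex K \<Longrightarrow> F \<in> K \<Longrightarrow> weight K F > 0"
proof (induction K F rule: weight.induct)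
  case (1 K F)
  show ?case
  proof (cases "facet K F")
    case False
    have "finite K" using 1 by (simp add: simplicial_complex_def)
    moreover have "{G \<in> K. F \<subset> G \<and> card G = card F + 1} \<noteq> {}"
      using coface_of_non_facet[OF 1(2,3) finite_face[OF 1(2,3)] False] by blast
    ultimately have "(\<Sum>G\<in>{G \<in> K. F \<subset> G \<and> card G = card F + 1}. weight K G) > 0"
      using 1 False by (intro sum_pos) auto
    with 1 False show ?thesis by (subst weight.simps) simp
  qed (use 1 in \<open>simp add: weight.simps\<close>)
qed

text \<open>The face \<open>G\<close> witnesses that \<open>F\<close> is not a facet; on a facet the
  weight is 1 while the sum is empty.\<close>

lemma weight_eq_sum:
  assumes "simplicial_complex K" "F \<in> faces i K" "G \<in> faces (i + 1) K" "F \<subset> G"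
  shows "weight K F = (\<Sum>G\<in>{G \<in> faces (i + 1) K. F \<subset> G}. weight K G)"
proof -
  have "\<not> facet K F" "F \<in> K" using assms by (auto simp: facet_def faces_def)
  moreover have "{G \<in> K. F \<subset> G \<and> card G = card F + 1} = {G \<in> faces (i + 1) K. F \<subset> G}"
    using assms(2) by (auto simp: faces_def)
  ultimately show ?thesis using assms(1) by (subst weight.simps) simp
qed

text \<open>The inner sum is the coboundary of \<open>f\<close> at \<open>G\<close>, and the outer
  sum is the adjoint of the coboundary for the inner products weighted by \<open>weight K\<close>.
  This form yields the quadratic form of the Laplacian.\<close>

lemma up_laplacian_factored:
  assumes "simplicial_complex K" "F \<in> faces i K"
  shows "up_laplacian K \<omega> i f F =
    (\<Sum>G\<in>{G \<in> faces (i + 1) K. F \<subset> G}. weight K G / weight K F * incidence_sign \<omega> F G *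
      (\<Sum>F'\<in>{F' \<in> faces i K. F' \<subset> G}. incidence_sign \<omega> F' G * f F'))"
proof -
  define T where "T = {G \<in> faces (i + 1) K. F \<subset> G}"
  define h where "h F' G = weight K G / weight K F * incidence_sign \<omega> F G * incidence_sign \<omega> F' G * f F'" for F' G
  let ?R = "\<lambda>G. {F' \<in> faces i K. F' \<subset> G \<and> F' \<noteq> F}"
  have fin: "finite (faces j K)" for j using assms(1) by (rule faces_finite)
  \<comment> \<open>This is the off-diagonal part: the coface \<open>G\<close> is recovered from
    \<open>F'\<close> as \<open>F \<union> F'\<close>.\<close>
  have "(\<Sum>G\<in>T. \<Sum>F'\<in>?R G. h F' G) =
      (\<Sum>F'\<in>{F' \<in> faces i K. F' \<noteq> F \<and> F \<union> F' \<in> faces (i + 1) K}. h F' (F \<union> F'))"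
  proof -
    have "(\<Sum>G\<in>T. \<Sum>F'\<in>?R G. h F' G) = (\<Sum>(G, F')\<in>Sigma T ?R. h F' G)"
      using fin by (subst sum.Sigma) (auto simp: T_def)
    also have "\<dots> = (\<Sum>F'\<in>{F' \<in> faces i K. F' \<noteq> F \<and> F \<union> F' \<in> faces (i + 1) K}. h F' (F \<union> F'))"
    proof (rule sum.reindex_bij_witness[where i = "\<lambda>F'. (F \<union> F', F')" and j = snd], goal_cases)
      case (1 a)
      then show ?case using assms(2) by (auto simp: T_def dest: union_of_two_subfaces)
    next
      case (2 a)
      then show ?case using assms(2) by (auto simp: T_def dest: union_of_two_subfaces)
    next
      case (4 F')
      then have "F \<noteq> F \<union> F'" "F' \<noteq> F \<union> F'" using assms(2) by (auto simp: faces_def)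
      with 4 show ?case by (auto simp: T_def)
    next
      case (5 a)
      then show ?case using assms(2) by (auto simp: T_def dest: union_of_two_subfaces)
    qed simp
    finally show ?thesis .
  qed
  moreover have "weight K G / weight K F * incidence_sign \<omega> F G *
      (\<Sum>F'\<in>{F' \<in> faces i K. F' \<subset> G}. incidence_sign \<omega> F' G * f F') =
      weight K G / weight K F * f F + (\<Sum>F'\<in>?R G. h F' G)" if "G \<in> T" for G
  proof -
    \<comment> \<open>The summand \<open>F' = F\<close> is the diagonal part of the Laplacian,
      because its sign occurs squared.\<close>
    have "{F' \<in> faces i K. F' \<subset> G} = insert F (?R G)"
      using that assms(2) by (auto simp: T_def)
    moreover have "finite (?R G)" using fin by simp
    ultimately have "(\<Sum>F'\<in>{F' \<in> faces i K. F' \<subset> G}. incidence_sign \<omega> F' G * f F') =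
        incidence_sign \<omega> F G * f F + (\<Sum>F'\<in>?R G. incidence_sign \<omega> F' G * f F')"
      by simp
    then have "weight K G / weight K F * incidence_sign \<omega> F G *
      (\<Sum>F'\<in>{F' \<in> faces i K. F' \<subset> G}. incidence_sign \<omega> F' G * f F') =
      weight K G / weight K F * (incidence_sign \<omega> F G * incidence_sign \<omega> F G) * f F +
      weight K G / weight K F * incidence_sign \<omega> F G * (\<Sum>F'\<in>?R G. incidence_sign \<omega> F' G * f F')"
      by (simp only: distrib_left mult.assoc)
    also have "weight K G / weight K F * incidence_sign \<omega> F G * (\<Sum>F'\<in>?R G. incidence_sign \<omega> F' G * f F') =
       (\<Sum>F'\<in>?R G. h F' G)"
      by (simp add: h_def sum_distrib_left mult.assoc)
    finally show ?thesis by simp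
  qed
  ultimately show ?thesis
    unfolding up_laplacian_def T_def[symmetric] by (simp add: sum.distrib h_def)
qed

text \<open>Both claims come from expanding the sum of the squares
  \<open>(n * a x - t)\<^sup>2\<close>, where \<open>t\<close> is the sum of \<open>a\<close> and
  \<open>n\<close> the number of terms: it equals \<open>n\<close> times the defect in the
  inequality, so zero defect forces every \<open>n * a x\<close> to be \<open>t\<close>.\<close>

lemma Cauchy_Schwarz_ones:
  fixes a :: "'b \<Rightarrow> real"
  assumes "finite A"
  shows "(\<Sum>x\<in>A. a x)\<^sup>2 \<le> card A * (\<Sum>x\<in>A. (a x)\<^sup>2)"
    and "(\<Sum>x\<in>A. a x)\<^sup>2 = card A * (\<Sum>x\<in>A. (a x)\<^sup>2) \<Longrightarrow> x \<in> A \<Longrightarrow> card A * a x = (\<Sum>x\<in>A. a x)"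
proof -
  define n where "n = real (card A)"
  define t where "t = (\<Sum>x\<in>A. a x)"
  have "(\<Sum>x\<in>A. (n * a x - t)\<^sup>2) = (\<Sum>x\<in>A. n\<^sup>2 * (a x)\<^sup>2 - 2 * n * t * a x + t\<^sup>2)"
    by (intro sum.cong refl) (simp add: power2_eq_square algebra_simps)
  also have "\<dots> = n * (n * (\<Sum>x\<in>A. (a x)\<^sup>2) - t\<^sup>2)"
    by (simp add: sum.distrib sum_subtractf sum_distrib_left[symmetric] t_def[symmetric]
        n_def[symmetric]) (simp add: power2_eq_square algebra_simps)
  finally have eq: "(\<Sum>x\<in>A. (n * a x - t)\<^sup>2) = n * (n * (\<Sum>x\<in>A. (a x)\<^sup>2) - t\<^sup>2)" .
  have "(\<Sum>x\<in>A. (n * a x - t)\<^sup>2) \<ge> 0" by (intro sum_nonneg) simp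
  show "(\<Sum>x\<in>A. a x)\<^sup>2 \<le> card A * (\<Sum>x\<in>A. (a x)\<^sup>2)"
  proof (cases "A = {}")
    case False
    then have "n > 0" using assms by (simp add: n_def card_gt_0_iff)
    with eq \<open>(\<Sum>x\<in>A. (n * a x - t)\<^sup>2) \<ge> 0\<close> show ?thesis
      by (simp add: zero_le_mult_iff n_def t_def)
  qed simp
  assume "(\<Sum>x\<in>A. a x)\<^sup>2 = card A * (\<Sum>x\<in>A. (a x)\<^sup>2)" "x \<in> A"
  with eq have "(\<Sum>x\<in>A. (n * a x - t)\<^sup>2) = 0" by (simp add: n_def t_def)
  with \<open>x \<in> A\<close> assms show "card A * a x = (\<Sum>x\<in>A. a x)"
    by (simp add: sum_nonneg_eq_0_iff n_def t_def)
qed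

section \<open>Eigenvalues of the up Laplacian: existence, the bound \<open>i + 2\<close>, and the
  case of equality\<close>

context
  fixes K :: "'a set set" and \<omega> :: "'a set \<Rightarrow> 'a list" and i :: nat
  assumes K: "simplicial_complex K"
begin

text \<open>The matrix entry \<open>a F F'\<close> carries the factor \<open>1 / weight K F\<close>.
  Multiplying by \<open>weight K F\<close> leaves a sum over common cofaces that is symmetric in
  \<open>F\<close> and \<open>F'\<close>, so the operator is symmetrizable.\<close>

lemma finite_up_spectrum: "finite (up_spectrum K \<omega> i)"
  and up_spectrum_nonempty: "faces i K \<noteq> {} \<Longrightarrow> up_spectrum K \<omega> i \<noteq> {}"
proof -
  define a where "a F F' = (\<Sum>G\<in>{G \<in> faces (i + 1) K. F \<subset> G \<and> F' \<subset> G}.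
     weight K G / weight K F * incidence_sign \<omega> F G * incidence_sign \<omega> F' G)" for F F'
  have fin: "finite (faces j K)" for j using K by (rule faces_finite)
  have pos: "weight K F > 0" if "F \<in> faces i K" for F
    using that weight_pos[OF K] by (simp add: faces_def)
  have sym: "weight K F * a F F' = weight K F' * a F' F" if "F \<in> faces i K" "F' \<in> faces i K" for F F'
  proof -
    have "weight K F * a F F' = (\<Sum>G\<in>{G \<in> faces (i + 1) K. F \<subset> G \<and> F' \<subset> G}.
       weight K G * incidence_sign \<omega> F G * incidence_sign \<omega> F' G)"
      using pos[OF that(1)] by (simp add: a_def sum_distrib_left mult.assoc)
    moreover have "weight K F' * a F' F = (\<Sum>G\<in>{G \<in> faces (i + 1) K. F' \<subset> G \<and> F \<subset> G}.
       weight K G * incidence_sign \<omega> F' G * incidence_sign \<omega> F G)"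
      using pos[OF that(2)] by (simp add: a_def sum_distrib_left mult.assoc)
    ultimately show ?thesis
      by (auto intro!: sum.cong)
  qed
  have "(\<Sum>F'\<in>faces i K. a F F' * f F') = up_laplacian K \<omega> i f F" if "F \<in> faces i K" for f F
  proof -
    have "up_laplacian K \<omega> i f F = (\<Sum>G\<in>{G \<in> faces (i + 1) K. F \<subset> G}.
       \<Sum>F'\<in>{F' \<in> faces i K. F' \<subset> G}.
         weight K G / weight K F * incidence_sign \<omega> F G * incidence_sign \<omega> F' G * f F')"
      by (simp add: up_laplacian_factored[OF K that] sum_distrib_left mult.assoc)
    also have "\<dots> = (\<Sum>F'\<in>faces i K. \<Sum>G\<in>{G \<in> {G \<in> faces (i + 1) K. F \<subset> G}. F' \<subset> G}.
         weight K G / weight K F * incidence_sign \<omega> F G * incidence_sign \<omega> F' G * f F')"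
      using fin by (intro sum.swap_restrict) auto
    also have "\<dots> = (\<Sum>F'\<in>faces i K. a F F' * f F')"
      by (simp add: a_def sum_distrib_right conj_assoc)
    finally show ?thesis by simp
  qed
  then have eq: "up_spectrum K \<omega> i = {\<mu>. \<exists>f. (\<exists>F\<in>faces i K. f F \<noteq> 0) \<and>
      (\<forall>F\<in>faces i K. (\<Sum>F'\<in>faces i K. a F F' * f F') = \<mu> * f F)}"
    unfolding up_spectrum_def by auto
  show "up_spectrum K \<omega> i \<noteq> {}" if "faces i K \<noteq> {}"
    unfolding eq by (rule finite_nonempty_symmetrizable_spectrum(2)[OF fin that pos sym])
  show "finite (up_spectrum K \<omega> i)"
  proof (cases "faces i K = {}")
    case False
    show ?thesis
      unfolding eq by (rule finite_nonempty_symmetrizable_spectrum(1)[OF fin False pos sym])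
  qed (simp add: eq)
qed

lemma up_spectrum_bound:
  assumes "\<mu> \<in> up_spectrum K \<omega> i"
  shows "\<mu> \<le> real i + 2"
    and "\<mu> = real i + 2 \<Longrightarrow> \<exists>f. coherent K (incidence_sign \<omega>) i f"
proof -
  let ?S = "faces i K" and ?T = "faces (i + 1) K"
  let ?s = "incidence_sign \<omega>" and ?n = "real i + 2"
  from assms obtain f F0 where F0: "F0 \<in> ?S" "f F0 \<noteq> 0"
    and ev: "\<And>F. F \<in> ?S \<Longrightarrow> up_laplacian K \<omega> i f F = \<mu> * f F"
    unfolding up_spectrum_def by blast
  have fin: "finite (faces j K)" for j using K by (rule faces_finite)
  have pos: "weight K F > 0" if "F \<in> faces j K" for F j
    using that weight_pos[OF K] by (simp add: faces_def)
  define B where "B G = (\<Sum>F\<in>{F \<in> ?S. F \<subset> G}. ?s F G * f F)" for G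
  define Q where "Q G = (\<Sum>F\<in>{F \<in> ?S. F \<subset> G}. (?s F G * f F)\<^sup>2)" for G
  define N where "N = (\<Sum>F\<in>?S. weight K F * (f F)\<^sup>2)"
  have "N > 0" unfolding N_def using F0 fin pos
    by (intro sum_pos2[of _ F0]) (auto simp: less_imp_le)
  have "\<mu> * N = (\<Sum>F\<in>?S. weight K F * f F * (\<mu> * f F))"
    by (simp add: N_def sum_distrib_left power2_eq_square mult_ac)
  also have "\<dots> = (\<Sum>F\<in>?S. weight K F * f F * up_laplacian K \<omega> i f F)"
    by (intro sum.cong refl) (simp add: ev)
  also have "\<dots> = (\<Sum>F\<in>?S. \<Sum>G\<in>{G \<in> ?T. F \<subset> G}. weight K G * (?s F G * f F) * B G)"
  proof (intro sum.cong refl)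
    fix F assume F: "F \<in> ?S"
    then have "weight K F \<noteq> 0" using pos[OF F] by simp
    then show "weight K F * f F * up_laplacian K \<omega> i f F =
        (\<Sum>G\<in>{G \<in> ?T. F \<subset> G}. weight K G * (?s F G * f F) * B G)"
      unfolding up_laplacian_factored[OF K F] B_def[symmetric] sum_distrib_left
      by (intro sum.cong refl) simp
  qed
  also have "\<dots> = (\<Sum>G\<in>?T. \<Sum>F\<in>{F \<in> ?S. F \<subset> G}. weight K G * (?s F G * f F) * B G)"
    using fin by (intro sum.swap_restrict) auto
  also have "\<dots> = (\<Sum>G\<in>?T. weight K G * (B G)\<^sup>2)"
    by (simp add: B_def[symmetric] sum_distrib_left[symmetric] sum_distrib_right[symmetric])
      (simp add: power2_eq_square mult.assoc)
  finally have energy: "\<mu> * N = (\<Sum>G\<in>?T. weight K G * (B G)\<^sup>2)" .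
  have "(\<Sum>G\<in>?T. weight K G * Q G) = (\<Sum>G\<in>?T. \<Sum>F\<in>{F \<in> ?S. F \<subset> G}. weight K G * (f F)\<^sup>2)"
    by (simp add: Q_def power_mult_distrib sum_distrib_left power2_eq_square[of "incidence_sign _ _ _"])
  also have "\<dots> = (\<Sum>F\<in>?S. \<Sum>G\<in>{G \<in> ?T. F \<subset> G}. weight K G * (f F)\<^sup>2)"
    using fin by (intro sum.swap_restrict[symmetric]) auto
  \<comment> \<open>For an \<open>i\<close>-face with a coface the weights of the cofaces add up to
    its own weight. For one without, the left side is 0, while \<open>N\<close> still counts it;
    hence an inequality.\<close>
  also have "\<dots> \<le> N"
    unfolding N_def
  proof (intro sum_mono)
    fix F assume F: "F \<in> ?S"
    show "(\<Sum>G\<in>{G \<in> ?T. F \<subset> G}. weight K G * (f F)\<^sup>2) \<le> weight K F * (f F)\<^sup>2"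
    proof (cases "{G \<in> ?T. F \<subset> G} = {}")
      case True
      then show ?thesis using pos[OF F] by (simp only: sum.empty) simp
    next
      case False
      then obtain G where "G \<in> ?T" "F \<subset> G" by blast
      from weight_eq_sum[OF K F this] show ?thesis by (simp add: sum_distrib_right)
    qed
  qed
  finally have Q: "(\<Sum>G\<in>?T. weight K G * Q G) \<le> N" .
  have CS: "(B G)\<^sup>2 \<le> ?n * Q G" if "G \<in> ?T" for G
    using Cauchy_Schwarz_ones(1)[of "{F \<in> ?S. F \<subset> G}" "\<lambda>F. ?s F G * f F"] fin
      card_subfaces[OF K that] by (simp add: B_def Q_def add.commute)
  then have le: "weight K G * (B G)\<^sup>2 \<le> weight K G * (?n * Q G)" if "G \<in> ?T" for G
    using that pos[OF that] by (intro mult_left_mono) auto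
  have le_n: "(\<Sum>G\<in>?T. weight K G * (?n * Q G)) \<le> ?n * N"
    using mult_left_mono[OF Q, of ?n] by (simp add: sum_distrib_left mult.left_commute)
  have "\<mu> * N \<le> (\<Sum>G\<in>?T. weight K G * (?n * Q G))"
    unfolding energy by (intro sum_mono le)
  with le_n have "\<mu> * N \<le> ?n * N" by linarith
  with \<open>N > 0\<close> show "\<mu> \<le> ?n" by simp
  assume \<mu>: "\<mu> = ?n"
  have sum_eq: "(\<Sum>G\<in>?T. weight K G * (B G)\<^sup>2) = (\<Sum>G\<in>?T. weight K G * (?n * Q G))"
    using le_n \<open>\<mu> * N \<le> (\<Sum>G\<in>?T. weight K G * (?n * Q G))\<close> energy unfolding \<mu> by linarith
  \<comment> \<open>The sums agree and each term is bounded by its counterpart, so they agree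
    termwise; the positive weight then cancels.\<close>
  have eq: "(B G)\<^sup>2 = ?n * Q G" if "G \<in> ?T" for G
    using sum_mono_inv[OF sum_eq le that fin] pos[OF that] by simp
  have "\<exists>c. \<forall>F\<in>?S. F \<subset> G \<longrightarrow> ?s F G * f F = c" if G: "G \<in> ?T" for G
  proof (intro exI[of _ "B G / ?n"] ballI impI)
    fix F assume "F \<in> ?S" "F \<subset> G"
    then have "?n * (?s F G * f F) = B G"
      using Cauchy_Schwarz_ones(2)[of "{F \<in> ?S. F \<subset> G}" "\<lambda>F. ?s F G * f F" F] fin
        card_subfaces[OF K G] eq[OF G] by (simp add: B_def Q_def add.commute)
    then show "?s F G * f F = B G / ?n" by (simp add: field_simps)
  qed
  \<comment> \<open>Coherence demands a nonzero value below some \<open>(i + 1)\<close>-face. At an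
    \<open>i\<close>-face without coface the Laplacian vanishes, which is impossible at
    \<open>F0\<close> for the nonzero eigenvalue \<open>i + 2\<close>.\<close>
  moreover have "\<exists>G\<in>?T. F0 \<subset> G"
  proof (rule ccontr)
    assume "\<not> (\<exists>G\<in>?T. F0 \<subset> G)"
    then have "{G \<in> ?T. F0 \<subset> G} = {}" by blast
    then have "up_laplacian K \<omega> i f F0 = 0"
      unfolding up_laplacian_factored[OF K F0(1)] by (simp only: sum.empty)
    with ev[OF F0(1)] F0(2) \<mu> show False by simp
  qed
  ultimately have "coherent K ?s i f" using F0 unfolding coherent_def by blast
  then show "\<exists>f. coherent K ?s i f" by blast
qed

text \<open>On a coherent function the coboundary at \<open>G\<close> is a sum of
  \<open>i + 2\<close> equal terms, and averaging over the cofaces of \<open>F\<close> with weights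
  \<open>weight K G / weight K F\<close>, which add up to 1, preserves the factor
  \<open>i + 2\<close>.\<close>

lemma coherent_imp_up_spectrum:
  assumes "coherent K (incidence_sign \<omega>) i f"
  shows "real i + 2 \<in> up_spectrum K \<omega> i"
proof -
  let ?S = "faces i K" and ?T = "faces (i + 1) K"
  let ?s = "incidence_sign \<omega>"
  \<comment> \<open>At an \<open>i\<close>-face without coface the Laplacian is 0, so an
    eigenfunction for \<open>i + 2\<close> has to vanish there, whereas \<open>f\<close> is
    unconstrained.\<close>
  define f0 where "f0 F = (if \<exists>G\<in>?T. F \<subset> G then f F else 0)" for F
  from assms obtain c where c: "\<And>F G. G \<in> ?T \<Longrightarrow> F \<in> ?S \<Longrightarrow> F \<subset> G \<Longrightarrow> ?s F G * f F = c G"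
    and ne: "\<exists>G\<in>?T. \<exists>F\<in>?S. F \<subset> G \<and> f F \<noteq> 0"
    unfolding coherent_def by metis
  have "up_laplacian K \<omega> i f0 F = (real i + 2) * f0 F" if F: "F \<in> ?S" for F
  proof -
    have "up_laplacian K \<omega> i f0 F =
        (\<Sum>G\<in>{G \<in> ?T. F \<subset> G}. weight K G / weight K F * ((real i + 2) * f0 F))"
      unfolding up_laplacian_factored[OF K F]
    proof (intro sum.cong refl)
      fix G assume "G \<in> {G \<in> ?T. F \<subset> G}"
      then have G: "G \<in> ?T" "F \<subset> G" by auto
      have "(\<Sum>F'\<in>{F' \<in> ?S. F' \<subset> G}. ?s F' G * f0 F') = (\<Sum>F'\<in>{F' \<in> ?S. F' \<subset> G}. c G)"
        using G(1) by (intro sum.cong refl) (auto simp: f0_def c)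
      also have "\<dots> = (real i + 2) * c G"
        using card_subfaces[OF K G(1)] by (simp add: add.commute)
      also have "c G = ?s F G * f0 F" using G F c by (auto simp: f0_def)
      finally have "(\<Sum>F'\<in>{F' \<in> ?S. F' \<subset> G}. ?s F' G * f0 F') = (real i + 2) * (?s F G * f0 F)" .
      moreover have "w * s * (n * (s * x)) = w * (n * (s * s * x))" for w s n x :: real
        by (simp add: mult_ac)
      ultimately show "weight K G / weight K F * ?s F G * (\<Sum>F'\<in>{F' \<in> ?S. F' \<subset> G}. ?s F' G * f0 F') =
          weight K G / weight K F * ((real i + 2) * f0 F)"
        by (simp only: incidence_sign_square mult_1_left)
    qed
    also have "\<dots> = (real i + 2) * f0 F"
    proof (cases "\<exists>G\<in>?T. F \<subset> G")
      case True
      then obtain G where "G \<in> ?T" "F \<subset> G" by blast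
      from weight_eq_sum[OF K F this]
      have "(\<Sum>G\<in>{G \<in> ?T. F \<subset> G}. weight K G / weight K F) = weight K F / weight K F"
        by (simp only: sum_divide_distrib[symmetric])
      moreover have "weight K F \<noteq> 0" using weight_pos[OF K, of F] F by (simp add: faces_def)
      ultimately show ?thesis unfolding sum_distrib_right[symmetric] by simp
    qed (simp add: f0_def)
    finally show ?thesis .
  qed
  moreover have "\<exists>F\<in>?S. f0 F \<noteq> 0" using ne by (auto simp: f0_def)
  ultimately show ?thesis unfolding up_spectrum_def by blast
qed

text \<open>The hypothesis makes the spectrum nonempty, so that its \<open>Max\<close> is itself an
  eigenvalue.\<close>

lemma lambda_max_eq_iff:
  assumes "faces i K \<noteq> {}"
  shows "lambda_max K \<omega> i = real i + 2 \<longleftrightarrow> (\<exists>f. coherent K (incidence_sign \<omega>) i f)"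
proof
  assume "lambda_max K \<omega> i = real i + 2"
  moreover have "Max (up_spectrum K \<omega> i) \<in> up_spectrum K \<omega> i"
    using finite_up_spectrum up_spectrum_nonempty[OF assms] by (rule Max_in)
  ultimately show "\<exists>f. coherent K (incidence_sign \<omega>) i f"
    using up_spectrum_bound(2) by (simp add: lambda_max_def)
next
  assume "\<exists>f. coherent K (incidence_sign \<omega>) i f"
  then have "real i + 2 \<in> up_spectrum K \<omega> i" using coherent_imp_up_spectrum by blast
  then show "lambda_max K \<omega> i = real i + 2"
    unfolding lambda_max_def using up_spectrum_bound(1) finite_up_spectrum by (intro Max_eqI)
qed

end

section \<open>Balanced signed graphs\<close>

abbreviation sg_walk :: "'v signed_graph \<Rightarrow> 'v list \<Rightarrow> bool" where
  "sg_walk G vs \<equiv> vs \<noteq> [] \<and> successively (\<lambda>u v. {u, v} \<in> sg_edges G) vs"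

fun walk_sign :: "'v signed_graph \<Rightarrow> 'v list \<Rightarrow> real" where
  "walk_sign G (u # v # vs) = sg_sign G {u, v} * walk_sign G (v # vs)"
| "walk_sign G vs = 1"

text \<open>Signs sit on consecutive pairs, so the cut vertex \<open>y\<close> has to belong to both
  pieces.\<close>

lemma walk_sign_append: "walk_sign G (xs @ y # ys) = walk_sign G (xs @ [y]) * walk_sign G (y # ys)"
  by (induction xs rule: induct_list012) auto

lemma walk_sign_rev: "walk_sign G (rev vs) = walk_sign G vs"
proof (induction vs rule: induct_list012)
  case (3 u v vs)
  then show ?case
    using walk_sign_append[of G "rev vs" v "[u]"] by (simp add: insert_commute)
qed auto

lemma walk_sign_conv_prod:
  "walk_sign G vs = (\<Prod>k<length vs - 1. sg_sign G {vs ! k, vs ! Suc k})"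
  by (induction vs rule: induct_list012) (simp_all add: prod.lessThan_Suc_shift del: prod.lessThan_Suc)

lemma cycle_sign_conv_walk_sign:
  assumes "vs \<noteq> []"
  shows "(\<Prod>k<length vs. sg_sign G {vs ! k, vs ! (Suc k mod length vs)}) = walk_sign G (vs @ [hd vs])"
proof -
  have "vs ! (Suc k mod length vs) = (vs @ [hd vs]) ! Suc k" if "k < length vs" for k
  proof (cases "Suc k = length vs")
    case True
    with assms show ?thesis by (simp add: hd_conv_nth nth_append)
  qed (use that in \<open>simp add: nth_append\<close>)
  then show ?thesis
    unfolding walk_sign_conv_prod by (auto simp: nth_append intro!: prod.cong)
qed

context
  fixes G :: "'v signed_graph"
  assumes edges: "\<And>e. e \<in> sg_edges G \<Longrightarrow> e \<subseteq> sg_verts G \<and> card e = 2 \<and> (sg_sign G e = 1 \<or> sg_sign G e = - 1)"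
begin

lemma walk_sign_cases: "sg_walk G vs \<Longrightarrow> walk_sign G vs = 1 \<or> walk_sign G vs = - 1"
proof (induction vs rule: induct_list012)
  case (3 u v vs)
  then show ?case using edges[of "{u, v}"] by auto
qed auto

text \<open>Balance speaks about simple cycles of length at least 3. A closed walk, stored without
  its repeated endpoint, is cut at a repeated vertex into two shorter closed walks whose signs
  multiply; without repetition it is such a cycle or has at most two vertices.\<close>

lemma balanced_closed_walk:
  assumes "balanced G"
  shows "sg_walk G (vs @ [hd vs]) \<Longrightarrow> vs \<noteq> [] \<Longrightarrow> walk_sign G (vs @ [hd vs]) = 1"
proof (induction "length vs" arbitrary: vs rule: less_induct)
  case less
  show ?case
  proof (cases "distinct vs")
    case True
    consider u where "vs = [u]" | u v where "vs = [u, v]" | "length vs \<ge> 3"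
      using less.prems(2) by (cases vs; cases "tl vs"; cases "tl (tl vs)") auto
    then show ?thesis
    proof cases
      case (1 u)
      \<comment> \<open>A single vertex would need a loop, which \<open>card e = 2\<close>
        excludes.\<close>
      then show ?thesis using less.prems edges[of "{u, u}"] by simp
    next
      case (2 u v)
      \<comment> \<open>The same edge is traversed back and forth, so its sign is squared.\<close>
      then show ?thesis using less.prems edges[of "{u, v}"] by (auto simp: insert_commute)
    next
      case 3
      have adj: "{vs ! k, vs ! (Suc k mod length vs)} \<in> sg_edges G" if "k < length vs" for k
      proof -
        have "{(vs @ [hd vs]) ! k, (vs @ [hd vs]) ! Suc k} \<in> sg_edges G"
          using less.prems(1) that by (auto simp: successively_conv_nth)
        moreover have "(vs @ [hd vs]) ! Suc k = vs ! (Suc k mod length vs)"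
        proof (cases "Suc k = length vs")
          case True
          with less.prems(2) show ?thesis by (simp add: hd_conv_nth nth_append)
        qed (use that in \<open>simp add: nth_append\<close>)
        ultimately show ?thesis using that by (simp add: nth_append)
      qed
      then have "vs ! k \<in> sg_verts G" if "k < length vs" for k
        using edges that by blast
      then have "sg_cycle G vs"
        using 3 True adj by (auto simp: sg_cycle_def in_set_conv_nth)
      then have "walk_sign G (vs @ [hd vs]) > 0"
        using assms less.prems(2) by (auto simp: balanced_def simp flip: cycle_sign_conv_walk_sign)
      with walk_sign_cases[OF less.prems(1)] show ?thesis by auto
    qed
  next
    case False
    then obtain as bs cs y where vs: "vs = as @ [y] @ bs @ [y] @ cs"
      using not_distinct_decomp by blast
    \<comment> \<open>\<open>?b\<close> is the closed excursion between two visits to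
      \<open>y\<close>; \<open>?c\<close> is the original walk with that excursion removed.\<close>
    let ?b = "y # bs" and ?c = "as @ y # cs"
    have hd: "hd ?c = hd vs" by (cases as) (auto simp: vs)
    have "walk_sign G (vs @ [hd vs]) = walk_sign G (as @ [y]) * walk_sign G (y # bs @ y # cs @ [hd vs])"
      using walk_sign_append[of G as y "bs @ y # cs @ [hd vs]"] by (simp add: vs)
    also have "walk_sign G (y # bs @ y # cs @ [hd vs]) = walk_sign G (y # bs @ [y]) * walk_sign G (y # cs @ [hd vs])"
      using walk_sign_append[of G "y # bs" y "cs @ [hd vs]"] by simp
    also have "walk_sign G (as @ [y]) * (walk_sign G (y # bs @ [y]) * walk_sign G (y # cs @ [hd vs])) =
        walk_sign G (?b @ [hd ?b]) * walk_sign G (?c @ [hd ?c])"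
      using walk_sign_append[of G as y "cs @ [hd vs]"] by (simp add: hd)
    also have "walk_sign G (?b @ [hd ?b]) = 1"
    proof (rule less.hyps)
      have "sg_walk G (as @ (?b @ [y]) @ cs @ [hd vs])"
        using less.prems(1) vs by simp
      then show "sg_walk G (?b @ [hd ?b])"
        by (simp only: successively_append_iff) simp
    qed (auto simp: vs)
    also have "walk_sign G (?c @ [hd ?c]) = 1"
    proof (rule less.hyps)
      show "sg_walk G (?c @ [hd ?c])"
        using less.prems(1) unfolding hd
        by (cases cs) (auto simp: vs successively_append_iff successively_Cons)
    qed (auto simp: vs)
    finally show ?thesis by simp
  qed
qed

text \<open>The harder half of Harary's theorem: the potential of \<open>v\<close> is the sign of a
  chosen walk from a root of its component to \<open>v\<close>. Independence of the choice is the
  triviality of closed walks.\<close>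

lemma balanced_imp_potential:
  assumes "balanced G"
  shows "\<exists>p. (\<forall>v. p v = 1 \<or> p v = (- 1 :: real)) \<and> (\<forall>u v. {u, v} \<in> sg_edges G \<longrightarrow> sg_sign G {u, v} = p u * p v)"
proof -
  define reach where "reach u v \<longleftrightarrow> (\<exists>vs. sg_walk G vs \<and> hd vs = u \<and> last vs = v)" for u v
  \<comment> \<open>The choice depends on \<open>v\<close> just through the predicate
    \<open>\<lambda>u. reach u v\<close>, which is the same for adjacent vertices, so adjacent
    vertices get the same root.\<close>
  define root where "root v = (SOME u. reach u v)" for v
  define W where "W v = (SOME vs. sg_walk G vs \<and> hd vs = root v \<and> last vs = v)" for v
  have "reach v v" for v unfolding reach_def by (intro exI[of _ "[v]"]) auto
  then have "reach (root v) v" for v unfolding root_def by (rule someI)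
  then have "sg_walk G (W v) \<and> hd (W v) = root v \<and> last (W v) = v" for v
    unfolding reach_def W_def by (rule someI_ex)
  then have W: "sg_walk G (W v)" "hd (W v) = root v" "last (W v) = v" for v by blast+
  have step: "reach x v" if "reach x u" "{u, v} \<in> sg_edges G" for x u v
  proof -
    from that(1) obtain vs where "sg_walk G vs" "hd vs = x" "last vs = u" by (auto simp: reach_def)
    with that(2) show ?thesis
      unfolding reach_def by (intro exI[of _ "vs @ [v]"]) (auto simp: successively_append_iff)
  qed
  have "sg_sign G {u, v} = walk_sign G (W u) * walk_sign G (W v)" if e: "{u, v} \<in> sg_edges G" for u v
  proof -
    have "reach x u \<longleftrightarrow> reach x v" for x using step e by (metis insert_commute)
    then have root: "root u = root v" by (simp add: root_def)
    obtain us where us: "W u = us @ [u]" using W[of u] by (metis append_butlast_last_id)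
    obtain vs where vs: "W v = vs @ [v]" using W[of v] by (metis append_butlast_last_id)
    \<comment> \<open>From the root to \<open>u\<close>, across the edge to \<open>v\<close>, and
      back to the root: a closed walk, of which \<open>zs\<close> drops the final root.\<close>
    obtain zs where zs: "W u @ rev (W v) = zs @ [hd zs]" "zs \<noteq> []"
    proof
      have "rev (W v) = rev (tl (W v)) @ [root v]"
        using W[of v] by (metis hd_Cons_tl rev.simps(2))
      then show "W u @ rev (W v) = (W u @ rev (tl (W v))) @ [hd (W u @ rev (tl (W v)))]"
        using W[of u] root by simp
    qed (use W in simp)
    have "sg_walk G (W u @ rev (W v))"
      using W[of u] W[of v] e by (auto simp: successively_append_iff hd_rev insert_commute)
    then have "walk_sign G (W u @ rev (W v)) = 1"
      using balanced_closed_walk[OF assms] zs by simp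
    moreover have "walk_sign G (W u @ rev (W v)) = walk_sign G (W u) * (sg_sign G {u, v} * walk_sign G (W v))"
      using walk_sign_append[of G us u "v # rev vs"] walk_sign_rev[of G "W v"] by (simp add: us vs)
    ultimately show ?thesis
      using walk_sign_cases[OF W(1)[of u]] walk_sign_cases[OF W(1)[of v]] edges[OF e] by auto
  qed
  then show ?thesis
    using walk_sign_cases[OF W(1)] by (intro exI[of _ "\<lambda>v. walk_sign G (W v)"]) blast
qed

end

text \<open>Every vertex of a cycle lies on two of its edges, so the product of the edge signs is
  the square of a product of nonzero potentials.\<close>

lemma potential_imp_balanced:
  assumes "\<And>u v. {u, v} \<in> sg_edges G \<Longrightarrow> sg_sign G {u, v} = p u * p v \<and> p u \<noteq> 0"
  shows "balanced G"
  unfolding balanced_def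
proof (intro allI impI)
  fix vs assume "sg_cycle G vs"
  then have len: "length vs \<ge> 3" and e: "\<And>k. k < length vs \<Longrightarrow> {vs ! k, vs ! (Suc k mod length vs)} \<in> sg_edges G"
    by (auto simp: sg_cycle_def)
  let ?n = "length vs"
  \<comment> \<open>The inverse of the cyclic shift adds \<open>?n - 1\<close>, since a plain
    predecessor would be truncated at 0.\<close>
  have bij: "bij_betw (\<lambda>k. Suc k mod ?n) {..<?n} {..<?n}"
  proof (rule bij_betw_byWitness[where f' = "\<lambda>k. (k + ?n - 1) mod ?n"])
    show "\<forall>k\<in>{..<?n}. (Suc k mod ?n + ?n - 1) mod ?n = k"
    proof
      fix k assume "k \<in> {..<?n}"
      then show "(Suc k mod ?n + ?n - 1) mod ?n = k"
        by (cases "Suc k = ?n") auto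
    qed
    show "\<forall>k\<in>{..<?n}. Suc ((k + ?n - 1) mod ?n) mod ?n = k"
    proof
      fix k assume "k \<in> {..<?n}"
      moreover have "Suc (k + ?n - 1) = k + ?n" using len by simp
      ultimately show "Suc ((k + ?n - 1) mod ?n) mod ?n = k" by (simp add: mod_Suc_eq)
    qed
  qed (use len in \<open>auto intro!: mod_less_divisor\<close>)
  have "(\<Prod>k<?n. sg_sign G {vs ! k, vs ! (Suc k mod ?n)}) = (\<Prod>k<?n. p (vs ! k) * p (vs ! (Suc k mod ?n)))"
    using assms e by (intro prod.cong) auto
  also have "\<dots> = (\<Prod>k<?n. p (vs ! k)) * (\<Prod>k<?n. p (vs ! k))"
    using prod.reindex_bij_betw[OF bij, of "\<lambda>k. p (vs ! k)"] by (simp add: prod.distrib)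
  also have "\<dots> > 0"
  proof -
    have "(\<Prod>k<?n. p (vs ! k)) \<noteq> 0" using assms e by (metis lessThan_iff finite_lessThan prod_zero_iff)
    then show ?thesis by (metis not_real_square_gt_zero)
  qed
  finally show "(\<Prod>k<?n. sg_sign G {vs ! k, vs ! (Suc k mod ?n)}) > 0" .
qed

section \<open>Path connected complexes\<close>

text \<open>One step of a \<open>face_path\<close>, without the condition on non-consecutive faces.
  Connectedness then becomes a statement about a reflexive transitive closure, open to
  induction.\<close>

definition face_adjacent :: "nat \<Rightarrow> 'a set set \<Rightarrow> 'a set \<Rightarrow> 'a set \<Rightarrow> bool" where
  "face_adjacent d K F F' \<longleftrightarrow> F \<in> faces d K \<and> F' \<in> faces d K \<and> F \<inter> F' \<in> faces (d - 1) K"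

lemma face_adjacent_sym: "face_adjacent d K F F' \<Longrightarrow> face_adjacent d K F' F"
  by (simp add: face_adjacent_def Int_commute)

lemma face_path_imp_rtranclp:
  assumes "face_path d K Fs"
  shows "(face_adjacent d K)\<^sup>*\<^sup>* (hd Fs) (last Fs)"
proof -
  have "(face_adjacent d K)\<^sup>*\<^sup>* (hd Fs) (Fs ! k)" if "k < length Fs" for k
    using that
  proof (induction k)
    case 0
    then show ?case by (simp add: hd_conv_nth)
  next
    case (Suc k)
    then have "face_adjacent d K (Fs ! k) (Fs ! Suc k)"
      using assms by (auto simp: face_path_def face_adjacent_def)
    with Suc show ?case by (simp add: rtranclp.rtrancl_into_rtrancl)
  qed
  moreover have "Fs \<noteq> []" using assms by (simp add: face_path_def)
  ultimately show ?thesis by (simp add: last_conv_nth)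
qed

text \<open>A walk of minimal length has no chords, so it is a path.\<close>

lemma rtranclp_imp_face_path:
  assumes "d \<ge> 1" "F \<in> faces d K" "(face_adjacent d K)\<^sup>*\<^sup>* F F'"
  shows "\<exists>Fs. face_path d K Fs \<and> hd Fs = F \<and> last Fs = F'"
proof -
  let ?R = "face_adjacent d K"
  define n where "n = (LEAST n. (?R ^^ n) F F')"
  have "\<exists>n. (?R ^^ n) F F'" using assms(3) by (simp add: rtranclp_power)
  then have "(?R ^^ n) F F'" unfolding n_def by (rule LeastI_ex)
  then obtain f where f: "f 0 = F" "f n = F'" "\<And>k. k < n \<Longrightarrow> ?R (f k) (f (Suc k))"
    by (auto simp: relpowp_fun_conv)
  have mem: "f k \<in> faces d K" if "k \<le> n" for k
    using that f(1) f(3)[of "k - 1"] assms(2) by (cases k) (auto simp: face_adjacent_def)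
  \<comment> \<open>A chord from \<open>f j\<close> to \<open>f l\<close> gives a walk of length
    \<open>Suc j + (n - l)\<close>, which cannot be shorter than \<open>n\<close>.\<close>
  have no_chord: "l \<le> Suc j" if "f j \<inter> f l \<in> faces (d - 1) K" "j < l" "l \<le> n" for j l
  proof -
    have "(?R ^^ j) F (f j)"
      unfolding relpowp_fun_conv using f that by (intro exI[of _ f]) auto
    moreover have "?R (f j) (f l)" using that mem by (simp add: face_adjacent_def)
    ultimately have "(?R ^^ Suc j) F (f l)" by (rule relpowp_Suc_I)
    moreover have "(?R ^^ (n - l)) (f l) F'"
      unfolding relpowp_fun_conv using f that by (intro exI[of _ "\<lambda>k. f (k + l)"]) auto
    ultimately have "(?R ^^ (Suc j + (n - l))) F F'"
      by (rule relpowp_trans)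
    then have "n \<le> Suc j + (n - l)" unfolding n_def by (rule Least_le)
    with that show ?thesis by simp
  qed
  have iff: "f j \<inter> f l \<in> faces (d - 1) K \<longleftrightarrow> \<bar>int j - int l\<bar> = 1" if "j \<le> n" "l \<le> n" for j l
  proof
    assume *: "f j \<inter> f l \<in> faces (d - 1) K"
    \<comment> \<open>For \<open>j = l\<close> the intersection is the face itself. Since
      \<open>d \<ge> 1\<close>, the truncated \<open>d - 1\<close> really differs from
      \<open>d\<close>, which rules this out.\<close>
    have "card (f j) \<noteq> d - 1 + 1" using mem[OF that(1)] assms(1) by (simp add: faces_def)
    then have "j \<noteq> l" using * by (auto simp: faces_def)
    then consider "j < l" | "l < j" by linarith
    then show "\<bar>int j - int l\<bar> = 1"
    proof cases
      case 1
      with no_chord[OF * 1 that(2)] show ?thesis by simp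
    next
      case 2
      have "f l \<inter> f j \<in> faces (d - 1) K" using * by (simp only: Int_commute)
      from no_chord[OF this 2 that(1)] 2 show ?thesis by simp
    qed
  next
    assume "\<bar>int j - int l\<bar> = 1"
    then consider "l = Suc j" | "j = Suc l" by linarith
    then show "f j \<inter> f l \<in> faces (d - 1) K"
    proof cases
      case 1
      with f(3)[of j] that show ?thesis by (simp add: face_adjacent_def)
    next
      case 2
      with f(3)[of l] that show ?thesis by (simp add: face_adjacent_def Int_commute)
    qed
  qed
  show ?thesis
  proof (intro exI[of _ "map f [0..<Suc n]"] conjI)
    have nth: "map f [0..<Suc n] ! k = f k" if "k < Suc n" for k
      using that by (metis add_0 diff_zero nth_map_upt)
    show "face_path d K (map f [0..<Suc n])"
      unfolding face_path_def using mem iff nth by (auto simp del: upt_Suc)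
    show "hd (map f [0..<Suc n]) = F" using f(1) by (simp add: hd_map del: upt_Suc)
  qed (simp add: f(2))
qed

lemma face_path_connected_iff:
  assumes "d \<ge> 1"
  shows "face_path_connected d K \<longleftrightarrow>
    (\<forall>F\<in>faces d K. \<forall>F'\<in>faces d K. (face_adjacent d K)\<^sup>*\<^sup>* F F')"
  unfolding face_path_connected_def
  using face_path_imp_rtranclp rtranclp_imp_face_path[OF assms] by metis

section \<open>Coherent functions: invariance under switching, and balance\<close>

text \<open>The factor \<open>p F\<close> is absorbed into the function and \<open>p G\<close> into
  the constant attached to \<open>G\<close>.\<close>

lemma coherent_switch:
  assumes coh: "coherent K s i f"
    and s: "\<And>F G. F \<in> faces i K \<Longrightarrow> G \<in> faces (i + 1) K \<Longrightarrow> F \<subset> G \<Longrightarrow> s F G = p F * p G * s' F G"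
    and pp: "\<And>F. F \<in> K \<Longrightarrow> p F * p F = (1 :: real)"
  shows "coherent K s' i (\<lambda>F. p F * f F)"
  unfolding coherent_def
proof (intro conjI ballI)
  fix G assume G: "G \<in> faces (i + 1) K"
  with coh have "\<exists>c. \<forall>F\<in>faces i K. F \<subset> G \<longrightarrow> s F G * f F = c"
    unfolding coherent_def by (elim conjE bspec)
  then obtain c where c: "\<forall>F\<in>faces i K. F \<subset> G \<longrightarrow> s F G * f F = c" ..
  have "s' F G * (p F * f F) = p G * c" if F: "F \<in> faces i K" "F \<subset> G" for F
  proof -
    have "s F G * f F = c" using c F by blast
    then have "p G * c = (p G * p G) * (s' F G * (p F * f F))"
      unfolding s[OF F(1) G F(2)] by (auto simp only: mult_ac)
    also have "p G * p G = 1" using pp[of G] G by (simp add: faces_def)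
    finally show ?thesis by simp
  qed
  then show "\<exists>c. \<forall>F\<in>faces i K. F \<subset> G \<longrightarrow> s' F G * (p F * f F) = c"
    by (intro exI[of _ "p G * c"]) blast
next
  obtain G F where GF: "G \<in> faces (i + 1) K" "F \<in> faces i K" "F \<subset> G" "f F \<noteq> 0"
    using coh unfolding coherent_def by (elim conjE bexE)
  then have "p F \<noteq> 0" using pp[of F] by (auto simp: faces_def)
  with GF show "\<exists>G\<in>faces (i + 1) K. \<exists>F\<in>faces i K. F \<subset> G \<and> p F * f F \<noteq> 0"
    by (intro bexI[of _ G] bexI[of _ F]) auto
qed

text \<open>Removes the orientation from the problem: the switching factor is
  \<open>list_sign g (\<omega> F)\<close>, and because its square is 1, switching works in both
  directions.\<close>

lemma coherent_incidence_sign_iff_order_sign: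
  assumes "orientation K \<omega>" "inj_on g (vertices K)"
  shows "(\<exists>f. coherent K (incidence_sign \<omega>) i f) \<longleftrightarrow> (\<exists>f. coherent K (order_sign g) i f)"
proof -
  define p where "p F = list_sign g (\<omega> F)" for F
  have inj: "inj_on g F" if "F \<in> K" for F
    using assms(2) that by (rule_tac inj_on_subset) (auto simp: vertices_def)
  have pp: "p F * p F = 1" if "F \<in> K" for F
    using list_sign_cases[of "\<omega> F" g] assms(1) inj[OF that] that
    by (auto simp: p_def orientation_def)
  have eq: "incidence_sign \<omega> F G = p F * p G * order_sign g F G"
    if "F \<in> faces i K" "G \<in> faces (i + 1) K" "F \<subset> G" for F G
    unfolding p_def using that assms(1) inj
    by (intro incidence_sign_eq_order_sign) (auto simp: orientation_def faces_def)
  have eq': "order_sign g F G = p F * p G * incidence_sign \<omega> F G"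
    if "F \<in> faces i K" "G \<in> faces (i + 1) K" "F \<subset> G" for F G
  proof -
    have "p F * p G * incidence_sign \<omega> F G = (p F * p F) * (p G * p G) * order_sign g F G"
      by (simp only: eq[OF that] mult_ac)
    moreover have "p F * p F = 1" "p G * p G = 1" using pp that by (simp_all add: faces_def)
    ultimately show ?thesis by simp
  qed
  show ?thesis
    using coherent_switch[where p = p, OF _ eq pp] coherent_switch[where p = p, OF _ eq' pp] by blast
qed

lemma subface_exists:
  assumes "simplicial_complex K" "G \<in> faces (i + 1) K"
  shows "\<exists>F\<in>faces i K. F \<subset> G"
proof (rule ccontr)
  assume "\<not> ?thesis"
  then have "{F \<in> faces i K. F \<subset> G} = {}" by blast
  with card_subfaces[OF assms] show False by simp
qed

text \<open>A potential \<open>p\<close> lives on both kinds of faces; the equation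
  \<open>sgn = p F * p G\<close> says that \<open>p\<close> is coherent with constant
  \<open>p G\<close> at \<open>G\<close>. In the converse, path connectedness prevents a coherent
  function from vanishing on part of the \<open>(i + 1)\<close>-faces, where an unbalanced cycle
  could go unnoticed.\<close>

lemma balanced_iff_coherent:
  assumes K: "simplicial_complex K" and conn: "face_path_connected (i + 1) K"
    and ne: "faces (i + 1) K \<noteq> {}"
  shows "balanced (incidence_graph K \<omega> i) \<longleftrightarrow> (\<exists>f. coherent K (incidence_sign \<omega>) i f)"
proof
  let ?H = "incidence_graph K \<omega> i" and ?S = "faces i K" and ?T = "faces (i + 1) K"
  let ?s = "incidence_sign \<omega>"
  have edge_sign: "sg_sign ?H {F, G} = ?s F G" if "F \<subset> G" for F G
  proof -
    have "\<Inter>{F, G} = F" "\<Union>{F, G} = G" using that by auto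
    then show ?thesis by (simp only: incidence_graph_def signed_graph.simps)
  qed
  {
    assume bal: "balanced ?H"
    have edges: "e \<subseteq> sg_verts ?H \<and> card e = 2 \<and> (sg_sign ?H e = 1 \<or> sg_sign ?H e = - 1)"
      if "e \<in> sg_edges ?H" for e
    proof -
      from that obtain F G where e: "e = {F, G}" "F \<in> ?S" "G \<in> ?T" "F \<subset> G"
        by (auto simp: incidence_graph_def)
      then have "F \<noteq> G" by blast
      with e edge_sign[OF e(4)] incidence_sign_cases[of \<omega> F G] show ?thesis
        by (auto simp: incidence_graph_def)
    qed
    obtain p where p: "\<And>v. p v = 1 \<or> p v = (- 1 :: real)"
      "\<And>u v. {u, v} \<in> sg_edges ?H \<Longrightarrow> sg_sign ?H {u, v} = p u * p v"
      using balanced_imp_potential[OF edges bal] by blast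
    have sp: "?s F G * p F = p G" if "F \<in> ?S" "G \<in> ?T" "F \<subset> G" for F G
    proof -
      have "{F, G} \<in> sg_edges ?H" using that by (auto simp: incidence_graph_def)
      then have "?s F G = p F * p G" using p(2) edge_sign[OF that(3)] by metis
      then show ?thesis using p(1)[of F] by auto
    qed
    have p0: "p F \<noteq> 0" for F using p(1)[of F] by auto
    obtain G where G: "G \<in> ?T" using ne by blast
    obtain F where "F \<in> ?S" "F \<subset> G" using subface_exists[OF K G] by blast
    with G p0 have "\<exists>G\<in>?T. \<exists>F\<in>?S. F \<subset> G \<and> p F \<noteq> 0" by blast
    moreover have "\<forall>G\<in>?T. \<exists>c. \<forall>F\<in>?S. F \<subset> G \<longrightarrow> ?s F G * p F = c"
    proof
      fix G assume "G \<in> ?T"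
      then show "\<exists>c. \<forall>F\<in>?S. F \<subset> G \<longrightarrow> ?s F G * p F = c"
        using sp by (intro exI[of _ "p G"]) blast
    qed
    ultimately have "coherent K ?s i p" unfolding coherent_def by (intro conjI)
    then show "\<exists>f. coherent K ?s i f" by (rule exI[where x = p])
  next
    assume "\<exists>f. coherent K ?s i f"
    then obtain f where f: "coherent K ?s i f" ..
    note ex = f[unfolded coherent_def, THEN conjunct2]
    from bchoice[OF f[unfolded coherent_def, THEN conjunct1]] obtain c where "\<forall>G\<in>?T. \<forall>F\<in>?S. F \<subset> G \<longrightarrow> ?s F G * f F = c G" ..
    then have c: "\<And>F G. G \<in> ?T \<Longrightarrow> F \<in> ?S \<Longrightarrow> F \<subset> G \<Longrightarrow> ?s F G * f F = c G" by blast
    have s0: "?s F G \<noteq> 0" for F G using incidence_sign_cases[of \<omega> F G] by auto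
    from ex obtain G0 F0 where G0: "G0 \<in> ?T" "F0 \<in> ?S" "F0 \<subset> G0" "f F0 \<noteq> 0" by blast
    then have c0: "c G0 \<noteq> 0" using c[OF G0(1-3)] s0[of F0 G0] by auto
    have "c G \<noteq> 0" if G: "G \<in> ?T" for G
    proof -
      have "(face_adjacent (i + 1) K)\<^sup>*\<^sup>* G0 G"
        using conn G G0(1) by (simp add: face_path_connected_iff)
      then show ?thesis
      proof (induction rule: rtranclp_induct)
        case (step G1 G2)
        \<comment> \<open>The constants at \<open>G1\<close> and \<open>G2\<close> are both
          \<open>f E\<close> up to sign, so neither vanishes without the other.\<close>
        define E where "E = G1 \<inter> G2"
        have mem: "G1 \<in> ?T" "G2 \<in> ?T" "E \<in> ?S"
          using step.hyps(2) by (auto simp: face_adjacent_def E_def)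
        then have "E \<noteq> G1" "E \<noteq> G2" by (auto simp: faces_def)
        then have "E \<subset> G1" "E \<subset> G2" by (auto simp: E_def)
        with c[OF mem(1,3)] c[OF mem(2,3)] s0[of E G2] step.IH show ?case by auto
      qed (rule c0)
    qed
    then have f0: "f F \<noteq> 0" if "F \<in> ?S" "G \<in> ?T" "F \<subset> G" for F G
      using c[of G F] that by fastforce
    \<comment> \<open>The \<open>i\<close>-faces take the sign of \<open>f\<close>, the
      \<open>(i + 1)\<close>-faces that of their constant; cardinality keeps the two cases
      apart.\<close>
    define p where "p v = (if v \<in> ?S then sgn (f v) else sgn (c v))" for v
    show "balanced ?H"
    proof (rule potential_imp_balanced)
      fix u v assume "{u, v} \<in> sg_edges ?H"
      then obtain F G where e: "{u, v} = {F, G}" "F \<in> ?S" "G \<in> ?T" "F \<subset> G"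
        by (auto simp: incidence_graph_def)
      have "G \<notin> ?S" using e(3) by (auto simp: faces_def)
      then have pF: "p F = sgn (f F)" and pG: "p G = sgn (c G)" using e by (auto simp: p_def)
      have "sgn (?s F G) * sgn (f F) = sgn (c G)"
        using c[OF e(3,2,4)] by (metis sgn_mult)
      then have "?s F G = p F * p G \<and> p F \<noteq> 0 \<and> p G \<noteq> 0"
        using f0[OF e(2,3,4)] incidence_sign_cases[of \<omega> F G] unfolding pF pG
        by (auto simp: sgn_if split: if_splits)
      moreover have "p u * p v = p F * p G" "u = F \<or> u = G"
        using e(1) by (auto simp: doubleton_eq_iff)
      ultimately show "sg_sign ?H {u, v} = p u * p v \<and> p u \<noteq> 0"
        using edge_sign[OF e(4)] e(1) by auto
    qed
  }
qed

section \<open>Cartesian products\<close>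

text \<open>The bound \<open>n\<close> supplies the radix of a lexicographic code.\<close>

lemma bounded_injection_exists:
  assumes "finite A"
  shows "\<exists>(g :: 'a \<Rightarrow> nat) n. inj_on g A \<and> (\<forall>x\<in>A. g x < n)"
  using finite_imp_inj_to_nat_seg[OF assms] by (metis image_eqI mem_Collect_eq)

text \<open>Just the comparisons between removed and remaining vertices enter the sign. The map
  \<open>h\<close> will be the embedding of a factor as a layer of the product.\<close>

lemma order_sign_cong:
  assumes "\<And>x y. x \<in> G - F \<Longrightarrow> y \<in> F \<Longrightarrow> sgn (g (h y) - g (h x)) = sgn (g' y - g' x)" "inj h"
  shows "order_sign g (h ` F) (h ` G) = order_sign g' F G"
proof -
  have "h ` G - h ` F = h ` (G - F)" using assms(2) by (simp add: image_set_diff)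
  moreover have "inj_on h A" for A using assms(2) by (rule inj_on_subset) simp
  ultimately show ?thesis
    using assms(1) by (simp add: order_sign_def prod.reindex)
qed

lemma Times_singleton_image: "A \<times> {v} = (\<lambda>u. (u, v)) ` A" "{u} \<times> B = Pair u ` B"
  by auto

text \<open>Vertices of the product are compared lexicographically, so that all layers are ordered alike.\<close>

lemma product_order_exists:
  assumes "finite (A :: 'a set)" "finite (B :: 'b set)"
  obtains g :: "'a \<times> 'b \<Rightarrow> real" and g1 :: "'a \<Rightarrow> real" and g2 :: "'b \<Rightarrow> real"
  where "inj_on g (A \<times> B)" "inj_on g1 A" "inj_on g2 B"
    "\<And>F G v. order_sign g (F \<times> {v}) (G \<times> {v}) = order_sign g1 F G"
    "\<And>F G u. order_sign g ({u} \<times> F) ({u} \<times> G) = order_sign g2 F G"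
proof -
  obtain h1 :: "'a \<Rightarrow> nat" where h1: "inj_on h1 A" using bounded_injection_exists[OF assms(1)] by blast
  obtain h2 :: "'b \<Rightarrow> nat" and n where h2: "inj_on h2 B" "\<And>y. y \<in> B \<Longrightarrow> h2 y < n"
    using bounded_injection_exists[OF assms(2)] by blast
  \<comment> \<open>The radix \<open>Suc n\<close> exceeds all values of \<open>h2\<close> on
    \<open>B\<close>, so the code determines both coordinates, and it is positive whatever
    \<open>n\<close> is.\<close>
  define g where "g = (\<lambda>(x, y). real (h1 x * Suc n + h2 y))"
  show ?thesis
  proof
    show "inj_on g (A \<times> B)"
    proof (rule inj_onI)
      fix p q assume pq: "p \<in> A \<times> B" "q \<in> A \<times> B" "g p = g q"
      obtain x y x' y' where p: "p = (x, y)" and q: "q = (x', y')" by (cases p, cases q)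
      have eq: "h1 x * Suc n + h2 y = h1 x' * Suc n + h2 y'"
        using pq(3) by (simp only: g_def p q prod.case of_nat_eq_iff)
      have lt: "h2 y < Suc n" "h2 y' < Suc n" using pq h2(2) by (auto simp: p q less_SucI)
      have "h1 x = h1 x'"
        using arg_cong[OF eq, of "\<lambda>k. k div Suc n"] lt by (simp del: mult_Suc_right)
      moreover from this eq have "h2 y = h2 y'" by simp
      ultimately show "p = q" using pq(1,2) h1 h2(1) by (auto simp: p q dest: inj_onD)
    qed
    show "inj_on (\<lambda>x. real (h1 x)) A" "inj_on (\<lambda>y. real (h2 y)) B"
      using h1 h2(1) by (auto simp: inj_on_def)
    show "order_sign g (F \<times> {v}) (G \<times> {v}) = order_sign (\<lambda>x. real (h1 x)) F G" for F G v
      unfolding Times_singleton_image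
    proof (rule order_sign_cong)
      fix x y
      \<comment> \<open>Inside a horizontal layer the code is scaled by the positive radix, which
        leaves signs alone.\<close>
      have "g (y, v) - g (x, v) = (real (h1 y) - real (h1 x)) * real (Suc n)"
        by (simp add: g_def algebra_simps)
      then show "sgn (g (y, v) - g (x, v)) = sgn (real (h1 y) - real (h1 x))"
        by (simp add: sgn_mult del: of_nat_Suc)
    qed (auto simp: inj_def)
    show "order_sign g ({u} \<times> F) ({u} \<times> G) = order_sign (\<lambda>y. real (h2 y)) F G" for F G u
      unfolding Times_singleton_image by (rule order_sign_cong) (auto simp: inj_def g_def)
  qed
qed

lemma faces_cartesian_product:
  "H \<in> faces j (K1 \<box> K2) \<longleftrightarrow>
     (\<exists>F v. H = F \<times> {v} \<and> F \<in> faces j K1 \<and> v \<in> vertices K2) \<or>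
     (\<exists>u F. H = {u} \<times> F \<and> u \<in> vertices K1 \<and> F \<in> faces j K2)"
  by (auto simp: faces_def cartesian_product_def card_cartesian_product card_cartesian_product_singleton)

lemma vertices_cartesian_product: "vertices (K1 \<box> K2) \<subseteq> vertices K1 \<times> vertices K2"
  by (auto simp: vertices_def cartesian_product_def)

lemma mem_face_vertices: "F \<in> faces j K \<Longrightarrow> x \<in> F \<Longrightarrow> x \<in> vertices K"
  by (auto simp: faces_def vertices_def)

lemma face_obtain_vertex:
  assumes "F \<in> faces j K"
  obtains x where "x \<in> F" "x \<in> vertices K"
proof -
  have "F \<noteq> {}" using assms by (auto simp: faces_def)
  then show ?thesis using mem_face_vertices[OF assms] that by blast
qed

text \<open>Projection recovers the face of the factor regardless of how \<open>H\<close> arose in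
  the product; a single vertex, for instance, lies in layers of both kinds.\<close>

lemma subface_product_left:
  assumes "H \<subseteq> G \<times> {v}" "H \<in> faces i (K1 \<box> K2)" "G \<in> K1" "simplicial_complex K1"
  obtains F where "H = F \<times> {v}" "F \<in> faces i K1"
proof
  show H: "H = fst ` H \<times> {v}" using assms(1) by force
  have "fst ` H \<subseteq> G" using assms(1) by auto
  then have "fst ` H \<in> K1" using assms(3,4) by (auto simp: simplicial_complex_def)
  moreover have "card (fst ` H) = card H"
    using arg_cong[OF H, of card] by (simp add: card_cartesian_product)
  ultimately show "fst ` H \<in> faces i K1" using assms(2) by (simp add: faces_def)
qed

lemma subface_product_right:
  assumes "H \<subseteq> {u} \<times> G" "H \<in> faces i (K1 \<box> K2)" "G \<in> K2" "simplicial_complex K2"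
  obtains F where "H = {u} \<times> F" "F \<in> faces i K2"
proof
  show H: "H = {u} \<times> snd ` H" using assms(1) by force
  have "snd ` H \<subseteq> G" using assms(1) by auto
  then have "snd ` H \<in> K2" using assms(3,4) by (auto simp: simplicial_complex_def)
  moreover have "card (snd ` H) = card H"
    using arg_cong[OF H, of card] by (simp add: card_cartesian_product_singleton)
  ultimately show "snd ` H \<in> faces i K2" using assms(2) by (simp add: faces_def)
qed

section \<open>Coherent functions on a product and on its layers\<close>

context
  fixes K1 :: "'a set set" and K2 :: "'b set set" and i :: nat
    and s :: "('a \<times> 'b) set \<Rightarrow> ('a \<times> 'b) set \<Rightarrow> real" and s1 s2
  assumes K1: "simplicial_complex K1" and K2: "simplicial_complex K2"
    and s1: "\<And>F G v. s (F \<times> {v}) (G \<times> {v}) = s1 F G"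
    and s2: "\<And>F G u. s ({u} \<times> F) ({u} \<times> G) = s2 F G"
begin

text \<open>The constancy conditions are inherited from the product. Nontriviality is not, since
  \<open>f\<close> may vanish on a given layer, so a nonzero value in the layer is supplied.\<close>

lemma coherent_restrict_left:
  assumes f: "coherent (K1 \<box> K2) s i f" and v: "v \<in> vertices K2"
    and ne: "G1 \<in> faces (i + 1) K1" "F1 \<in> faces i K1" "F1 \<subset> G1" "f (F1 \<times> {v}) \<noteq> 0"
  shows "coherent K1 s1 i (\<lambda>F. f (F \<times> {v}))"
  unfolding coherent_def
proof (intro conjI ballI)
  fix G assume "G \<in> faces (i + 1) K1"
  then have "G \<times> {v} \<in> faces (i + 1) (K1 \<box> K2)" using v by (auto simp: faces_cartesian_product)
  from bspec[OF f[unfolded coherent_def, THEN conjunct1] this] obtain c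
    where c: "\<forall>H\<in>faces i (K1 \<box> K2). H \<subset> G \<times> {v} \<longrightarrow> s H (G \<times> {v}) * f H = c" ..
  have "s1 F G * f (F \<times> {v}) = c" if "F \<in> faces i K1" "F \<subset> G" for F
  proof -
    have "F \<times> {v} \<in> faces i (K1 \<box> K2)" using v that by (auto simp: faces_cartesian_product)
    moreover have "F \<times> {v} \<subset> G \<times> {v}" using that by auto
    ultimately have "s (F \<times> {v}) (G \<times> {v}) * f (F \<times> {v}) = c" using c by blast
    then show ?thesis by (simp only: s1)
  qed
  then show "\<exists>c. \<forall>F\<in>faces i K1. F \<subset> G \<longrightarrow> s1 F G * f (F \<times> {v}) = c" by (intro exI[of _ c]) blast
qed (use ne in blast)

lemma coherent_restrict_right:
  assumes f: "coherent (K1 \<box> K2) s i f" and u: "u \<in> vertices K1"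
    and ne: "G2 \<in> faces (i + 1) K2" "F2 \<in> faces i K2" "F2 \<subset> G2" "f ({u} \<times> F2) \<noteq> 0"
  shows "coherent K2 s2 i (\<lambda>F. f ({u} \<times> F))"
  unfolding coherent_def
proof (intro conjI ballI)
  fix G assume "G \<in> faces (i + 1) K2"
  then have "{u} \<times> G \<in> faces (i + 1) (K1 \<box> K2)" using u by (auto simp: faces_cartesian_product)
  from bspec[OF f[unfolded coherent_def, THEN conjunct1] this] obtain c
    where c: "\<forall>H\<in>faces i (K1 \<box> K2). H \<subset> {u} \<times> G \<longrightarrow> s H ({u} \<times> G) * f H = c" ..
  have "s2 F G * f ({u} \<times> F) = c" if "F \<in> faces i K2" "F \<subset> G" for F
  proof -
    have "{u} \<times> F \<in> faces i (K1 \<box> K2)" using u that by (auto simp: faces_cartesian_product)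
    moreover have "{u} \<times> F \<subset> {u} \<times> G" using that by auto
    ultimately have "s ({u} \<times> F) ({u} \<times> G) * f ({u} \<times> F) = c" using c by blast
    then show ?thesis by (simp only: s2)
  qed
  then show "\<exists>c. \<forall>F\<in>faces i K2. F \<subset> G \<longrightarrow> s2 F G * f ({u} \<times> F) = c" by (intro exI[of _ c]) blast
qed (use ne in blast)

text \<open>The face \<open>G\<close> above a nonzero value lies in some layer, and the restriction
  to that very layer is nontrivial.\<close>

lemma coherent_product_cases:
  assumes f: "coherent (K1 \<box> K2) s i f"
  shows "(\<exists>f. coherent K1 s1 i f) \<or> (\<exists>f. coherent K2 s2 i f)"
proof -
  obtain G F where G: "G \<in> faces (i + 1) (K1 \<box> K2)" and F: "F \<in> faces i (K1 \<box> K2)" "F \<subset> G" "f F \<noteq> 0"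
    using f[unfolded coherent_def, THEN conjunct2] by (elim bexE conjE)
  from G consider (left) G1 v where "G = G1 \<times> {v}" "G1 \<in> faces (i + 1) K1" "v \<in> vertices K2"
    | (right) u G2 where "G = {u} \<times> G2" "u \<in> vertices K1" "G2 \<in> faces (i + 1) K2"
    unfolding faces_cartesian_product by blast
  then show ?thesis
  proof cases
    case left
    then have "G1 \<in> K1" "F \<subseteq> G1 \<times> {v}" using F by (auto simp: faces_def)
    with F(1) K1 obtain F1 where F1: "F = F1 \<times> {v}" "F1 \<in> faces i K1"
      using subface_product_left by metis
    then have "F1 \<subset> G1" using F(2) left(1) by auto
    then have "coherent K1 s1 i (\<lambda>F. f (F \<times> {v}))"
      using coherent_restrict_left[OF f left(3,2) F1(2)] F(3) F1(1) by blast
    then show ?thesis by (intro disjI1 exI)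
  next
    case right
    then have "G2 \<in> K2" "F \<subseteq> {u} \<times> G2" using F by (auto simp: faces_def)
    with F(1) K2 obtain F2 where F2: "F = {u} \<times> F2" "F2 \<in> faces i K2"
      using subface_product_right by metis
    then have "F2 \<subset> G2" using F(2) right(1) by auto
    then have "coherent K2 s2 i (\<lambda>F. f ({u} \<times> F))"
      using coherent_restrict_right[OF f right(2,3) F2(2)] F(3) F2(1) by blast
    then show ?thesis by (intro disjI2 exI)
  qed
qed

text \<open>An \<open>(i + 1)\<close>-face of the product lies in a layer together with its whole
  boundary, so the conditions can be checked layer by layer.\<close>

lemma coherent_productI:
  assumes left: "\<And>G v. G \<in> faces (i + 1) K1 \<Longrightarrow> v \<in> vertices K2 \<Longrightarrow>
      \<exists>c. \<forall>F\<in>faces i K1. F \<subset> G \<longrightarrow> s1 F G * f (F \<times> {v}) = c"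
    and right: "\<And>u G. u \<in> vertices K1 \<Longrightarrow> G \<in> faces (i + 1) K2 \<Longrightarrow>
      \<exists>c. \<forall>F\<in>faces i K2. F \<subset> G \<longrightarrow> s2 F G * f ({u} \<times> F) = c"
    and ne: "G0 \<in> faces (i + 1) (K1 \<box> K2)" "F0 \<in> faces i (K1 \<box> K2)" "F0 \<subset> G0" "f F0 \<noteq> 0"
  shows "coherent (K1 \<box> K2) s i f"
  unfolding coherent_def
proof (intro conjI ballI)
  fix G assume "G \<in> faces (i + 1) (K1 \<box> K2)"
  then consider (left) G1 v where "G = G1 \<times> {v}" "G1 \<in> faces (i + 1) K1" "v \<in> vertices K2"
    | (right) u G2 where "G = {u} \<times> G2" "u \<in> vertices K1" "G2 \<in> faces (i + 1) K2"
    unfolding faces_cartesian_product by blast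
  then show "\<exists>c. \<forall>F\<in>faces i (K1 \<box> K2). F \<subset> G \<longrightarrow> s F G * f F = c"
  proof cases
    case left
    then have mem: "G1 \<in> K1" by (simp add: faces_def)
    obtain c where c: "\<forall>F\<in>faces i K1. F \<subset> G1 \<longrightarrow> s1 F G1 * f (F \<times> {v}) = c"
      using assms(1)[OF left(2,3)] ..
    show ?thesis
    proof (intro exI[of _ c] ballI impI)
      fix F assume F: "F \<in> faces i (K1 \<box> K2)" "F \<subset> G"
      then have "F \<subseteq> G1 \<times> {v}" using left(1) by blast
      with F(1) mem K1 obtain F1 where F1: "F = F1 \<times> {v}" "F1 \<in> faces i K1"
        using subface_product_left by metis
      then have "F1 \<subset> G1" using F(2) left(1) by auto
      with c F1(2) have "s1 F1 G1 * f (F1 \<times> {v}) = c" by blast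
      then show "s F G * f F = c" by (simp only: F1(1) left(1) s1)
    qed
  next
    case right
    then have mem: "G2 \<in> K2" by (simp add: faces_def)
    obtain c where c: "\<forall>F\<in>faces i K2. F \<subset> G2 \<longrightarrow> s2 F G2 * f ({u} \<times> F) = c"
      using assms(2)[OF right(2,3)] ..
    show ?thesis
    proof (intro exI[of _ c] ballI impI)
      fix F assume F: "F \<in> faces i (K1 \<box> K2)" "F \<subset> G"
      then have "F \<subseteq> {u} \<times> G2" using right(1) by blast
      with F(1) mem K2 obtain F2 where F2: "F = {u} \<times> F2" "F2 \<in> faces i K2"
        using subface_product_right by metis
      then have "F2 \<subset> G2" using F(2) right(1) by auto
      with c F2(2) have "s2 F2 G2 * f ({u} \<times> F2) = c" by blast
      then show "s F G * f F = c" by (simp only: F2(1) right(1) s2)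
    qed
  qed
qed (use ne in blast)

lemma coherent_extend_left:
  assumes i: "i \<ge> 1" and f: "coherent K1 s1 i f" and v0: "v0 \<in> vertices K2"
  shows "coherent (K1 \<box> K2) s i (\<lambda>H. if snd ` H = {v0} then f (fst ` H) else 0)"
proof -
  obtain G0 F0 where ne: "G0 \<in> faces (i + 1) K1" "F0 \<in> faces i K1" "F0 \<subset> G0" "f F0 \<noteq> 0"
    using f[unfolded coherent_def, THEN conjunct2] by (elim bexE conjE)
  have nonempty: "F \<noteq> {}" if "F \<in> faces i K1" for F using that by (auto simp: faces_def)
  show ?thesis
  proof (rule coherent_productI[where ?G0.0 = "G0 \<times> {v0}" and ?F0.0 = "F0 \<times> {v0}"])
    fix G v assume G: "G \<in> faces (i + 1) K1" "v \<in> vertices K2"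
    obtain c where c: "\<forall>F\<in>faces i K1. F \<subset> G \<longrightarrow> s1 F G * f F = c"
      using bspec[OF f[unfolded coherent_def, THEN conjunct1] G(1)] ..
    show "\<exists>c. \<forall>F\<in>faces i K1. F \<subset> G \<longrightarrow>
      s1 F G * (if snd ` (F \<times> {v}) = {v0} then f (fst ` (F \<times> {v})) else 0) = c"
    proof (intro exI[of _ "if v = v0 then c else 0"] ballI impI)
      fix F assume F: "F \<in> faces i K1" "F \<subset> G"
      then have "snd ` (F \<times> {v}) = {v}" "fst ` (F \<times> {v}) = F" using nonempty[OF F(1)] by auto
      then show "s1 F G * (if snd ` (F \<times> {v}) = {v0} then f (fst ` (F \<times> {v})) else 0) =
        (if v = v0 then c else 0)"
        using c F by simp
    qed
  next
    fix u G
    show "\<exists>c. \<forall>F\<in>faces i K2. F \<subset> G \<longrightarrow>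
      s2 F G * (if snd ` ({u} \<times> F) = {v0} then f (fst ` ({u} \<times> F)) else 0) = c"
    proof (intro exI[of _ 0] ballI impI)
      fix F assume "F \<in> faces i K2"
      \<comment> \<open>Here \<open>i \<ge> 1\<close> enters: a vertical \<open>i\<close>-face has
        at least two second coordinates and fails the test.\<close>
      then have "F \<noteq> {v0}" using i by (auto simp: faces_def)
      moreover have "snd ` ({u} \<times> F) = F" by force
      ultimately show "s2 F G * (if snd ` ({u} \<times> F) = {v0} then f (fst ` ({u} \<times> F)) else 0) = 0"
        by simp
    qed
  next
    show "G0 \<times> {v0} \<in> faces (i + 1) (K1 \<box> K2)" "F0 \<times> {v0} \<in> faces i (K1 \<box> K2)"
      using ne v0 by (auto simp: faces_cartesian_product)
    show "F0 \<times> {v0} \<subset> G0 \<times> {v0}" using ne(3) by auto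
    have "snd ` (F0 \<times> {v0}) = {v0}" "fst ` (F0 \<times> {v0}) = F0" using nonempty[OF ne(2)] by auto
    then show "(if snd ` (F0 \<times> {v0}) = {v0} then f (fst ` (F0 \<times> {v0})) else 0) \<noteq> 0"
      using ne(4) by simp
  qed
qed

lemma coherent_extend_right:
  assumes i: "i \<ge> 1" and f: "coherent K2 s2 i f" and u0: "u0 \<in> vertices K1"
  shows "coherent (K1 \<box> K2) s i (\<lambda>H. if fst ` H = {u0} then f (snd ` H) else 0)"
proof -
  obtain G0 F0 where ne: "G0 \<in> faces (i + 1) K2" "F0 \<in> faces i K2" "F0 \<subset> G0" "f F0 \<noteq> 0"
    using f[unfolded coherent_def, THEN conjunct2] by (elim bexE conjE)
  have nonempty: "F \<noteq> {}" if "F \<in> faces i K2" for F using that by (auto simp: faces_def)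
  show ?thesis
  proof (rule coherent_productI[where ?G0.0 = "{u0} \<times> G0" and ?F0.0 = "{u0} \<times> F0"])
    fix u G assume G: "u \<in> vertices K1" "G \<in> faces (i + 1) K2"
    obtain c where c: "\<forall>F\<in>faces i K2. F \<subset> G \<longrightarrow> s2 F G * f F = c"
      using bspec[OF f[unfolded coherent_def, THEN conjunct1] G(2)] ..
    show "\<exists>c. \<forall>F\<in>faces i K2. F \<subset> G \<longrightarrow>
      s2 F G * (if fst ` ({u} \<times> F) = {u0} then f (snd ` ({u} \<times> F)) else 0) = c"
    proof (intro exI[of _ "if u = u0 then c else 0"] ballI impI)
      fix F assume F: "F \<in> faces i K2" "F \<subset> G"
      then have "fst ` ({u} \<times> F) = {u}" "snd ` ({u} \<times> F) = F" using nonempty[OF F(1)] by auto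
      then show "s2 F G * (if fst ` ({u} \<times> F) = {u0} then f (snd ` ({u} \<times> F)) else 0) =
        (if u = u0 then c else 0)"
        using c F by simp
    qed
  next
    fix G v
    show "\<exists>c. \<forall>F\<in>faces i K1. F \<subset> G \<longrightarrow>
      s1 F G * (if fst ` (F \<times> {v}) = {u0} then f (snd ` (F \<times> {v})) else 0) = c"
    proof (intro exI[of _ 0] ballI impI)
      fix F assume "F \<in> faces i K1"
      then have "F \<noteq> {u0}" using i by (auto simp: faces_def)
      moreover have "fst ` (F \<times> {v}) = F" by force
      ultimately show "s1 F G * (if fst ` (F \<times> {v}) = {u0} then f (snd ` (F \<times> {v})) else 0) = 0"
        by simp
    qed
  next
    show "{u0} \<times> G0 \<in> faces (i + 1) (K1 \<box> K2)" "{u0} \<times> F0 \<in> faces i (K1 \<box> K2)"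
      using ne u0 by (auto simp: faces_cartesian_product)
    show "{u0} \<times> F0 \<subset> {u0} \<times> G0" using ne(3) by auto
    have "fst ` ({u0} \<times> F0) = {u0}" "snd ` ({u0} \<times> F0) = F0" using nonempty[OF ne(2)] by auto
    then show "(if fst ` ({u0} \<times> F0) = {u0} then f (snd ` ({u0} \<times> F0)) else 0) \<noteq> 0"
      using ne(4) by simp
  qed
qed

text \<open>Along an edge of one layer a single factor varies, and the other one merely scales the
  constant. For graphs a coherent function alternates in sign along edges, so this is the product of
  two bipartite colourings.\<close>

lemma coherent_vertex_product:
  assumes i: "i = 0" and f1: "coherent K1 s1 i f1" and f2: "coherent K2 s2 i f2"
  shows "coherent (K1 \<box> K2) s i (\<lambda>H. f1 (fst ` H) * f2 (snd ` H))"
proof -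
  obtain G1 F1 where ne1: "G1 \<in> faces (i + 1) K1" "F1 \<in> faces i K1" "F1 \<subset> G1" "f1 F1 \<noteq> 0"
    using f1[unfolded coherent_def, THEN conjunct2] by (elim bexE conjE)
  obtain G2 F2 where ne2: "G2 \<in> faces (i + 1) K2" "F2 \<in> faces i K2" "F2 \<subset> G2" "f2 F2 \<noteq> 0"
    using f2[unfolded coherent_def, THEN conjunct2] by (elim bexE conjE)
  \<comment> \<open>With \<open>i = 0\<close> the face \<open>F2\<close> is a single vertex; since
    \<open>f2\<close> is nonzero there, the product is nonzero in the layer at
    \<open>v0\<close>.\<close>
  obtain v0 where v0: "F2 = {v0}" using ne2(2) i by (auto simp: faces_def card_1_singleton_iff)
  then have v0': "v0 \<in> vertices K2" using ne2(2) by (intro mem_face_vertices) auto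
  have nonempty: "F \<noteq> {}" if "F \<in> faces i K" for F and K :: "'c set set"
    using that by (auto simp: faces_def)
  have proj: "fst ` (F \<times> {v}) = F" "F \<noteq> {} \<Longrightarrow> snd ` (F \<times> {v}) = {v}"
    "snd ` ({u} \<times> F') = F'" "F' \<noteq> {} \<Longrightarrow> fst ` ({u} \<times> F') = {u}"
    for u :: 'a and v :: 'b and F F' by force+
  show ?thesis
  proof (rule coherent_productI[where ?G0.0 = "G1 \<times> {v0}" and ?F0.0 = "F1 \<times> {v0}"])
    fix G v assume G: "G \<in> faces (i + 1) K1"
    obtain c where c: "\<forall>F\<in>faces i K1. F \<subset> G \<longrightarrow> s1 F G * f1 F = c"
      using bspec[OF f1[unfolded coherent_def, THEN conjunct1] G] ..
    show "\<exists>c. \<forall>F\<in>faces i K1. F \<subset> G \<longrightarrow>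
      s1 F G * (f1 (fst ` (F \<times> {v})) * f2 (snd ` (F \<times> {v}))) = c"
    proof (intro exI[of _ "c * f2 {v}"] ballI impI)
      fix F assume F: "F \<in> faces i K1" "F \<subset> G"
      then have "s1 F G * f1 F = c" using c by blast
      then show "s1 F G * (f1 (fst ` (F \<times> {v})) * f2 (snd ` (F \<times> {v}))) = c * f2 {v}"
        unfolding proj(1) proj(2)[OF nonempty[OF F(1)]] by auto
    qed
  next
    fix u G assume G: "G \<in> faces (i + 1) K2"
    obtain c where c: "\<forall>F\<in>faces i K2. F \<subset> G \<longrightarrow> s2 F G * f2 F = c"
      using bspec[OF f2[unfolded coherent_def, THEN conjunct1] G] ..
    show "\<exists>c. \<forall>F\<in>faces i K2. F \<subset> G \<longrightarrow>
      s2 F G * (f1 (fst ` ({u} \<times> F)) * f2 (snd ` ({u} \<times> F))) = c"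
    proof (intro exI[of _ "c * f1 {u}"] ballI impI)
      fix F assume F: "F \<in> faces i K2" "F \<subset> G"
      then have "s2 F G * f2 F = c" using c by blast
      then show "s2 F G * (f1 (fst ` ({u} \<times> F)) * f2 (snd ` ({u} \<times> F))) = c * f1 {u}"
        unfolding proj(3) proj(4)[OF nonempty[OF F(1)]] by auto
    qed
  next
    show "G1 \<times> {v0} \<in> faces (i + 1) (K1 \<box> K2)" "F1 \<times> {v0} \<in> faces i (K1 \<box> K2)"
      using ne1 v0' by (auto simp: faces_cartesian_product)
    show "F1 \<times> {v0} \<subset> G1 \<times> {v0}" using ne1(3) by auto
    show "f1 (fst ` (F1 \<times> {v0})) * f2 (snd ` (F1 \<times> {v0})) \<noteq> 0"
      unfolding proj(1) proj(2)[OF nonempty[OF ne1(2)]] using ne1(4) ne2(4) v0 by simp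
  qed
qed

text \<open>A vertex \<open>(u, v)\<close> with nonzero value lies in one layer of each kind. Edges
  of the factors through \<open>u\<close> and \<open>v\<close> make both restrictions nontrivial,
  which is where the covering assumptions enter.\<close>

lemma coherent_vertex_product_imp:
  assumes i: "i = 0" and f: "coherent (K1 \<box> K2) s i f"
    and c1: "\<forall>u\<in>vertices K1. \<exists>e\<in>faces 1 K1. u \<in> e"
    and c2: "\<forall>v\<in>vertices K2. \<exists>e\<in>faces 1 K2. v \<in> e"
  shows "(\<exists>f. coherent K1 s1 i f) \<and> (\<exists>f. coherent K2 s2 i f)"
proof -
  obtain F where F: "F \<in> faces i (K1 \<box> K2)" "f F \<noteq> 0"
    using f[unfolded coherent_def, THEN conjunct2] by (elim bexE conjE)
  then obtain u v where uv: "F = {(u, v)}" using i by (auto simp: faces_def card_1_singleton_iff)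
  have "(u, v) \<in> vertices (K1 \<box> K2)" using F(1) uv by (intro mem_face_vertices) auto
  then have u: "u \<in> vertices K1" and v: "v \<in> vertices K2" using vertices_cartesian_product by blast+
  obtain e1 where e1: "e1 \<in> faces 1 K1" "u \<in> e1" using c1 u by blast
  obtain e2 where e2: "e2 \<in> faces 1 K2" "v \<in> e2" using c2 v by blast
  have sub: "{x} \<in> faces i K \<and> {x} \<subset> e" if "simplicial_complex K" "e \<in> faces 1 K" "x \<in> e"
    for x e and K :: "'c set set"
  proof -
    have "{x} \<in> K" using that by (auto simp: simplicial_complex_def faces_def)
    moreover have "{x} \<noteq> e" using that(2) by (auto simp: faces_def)
    ultimately show ?thesis using that(3) i by (auto simp: faces_def)
  qed
  have "coherent K1 s1 i (\<lambda>F. f (F \<times> {v}))"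
    using sub[OF K1 e1] e1 F(2) i
    by (intro coherent_restrict_left[OF f v, of e1 "{u}"]) (auto simp: uv)
  moreover have "coherent K2 s2 i (\<lambda>F. f ({u} \<times> F))"
    using sub[OF K2 e2] e2 F(2) i
    by (intro coherent_restrict_right[OF f u, of e2 "{v}"]) (auto simp: uv)
  ultimately show ?thesis by blast
qed

lemma ex_coherent_vertex_product_iff:
  assumes "i = 0" "\<forall>u\<in>vertices K1. \<exists>e\<in>faces 1 K1. u \<in> e" "\<forall>v\<in>vertices K2. \<exists>e\<in>faces 1 K2. v \<in> e"
  shows "(\<exists>f. coherent (K1 \<box> K2) s i f) \<longleftrightarrow> (\<exists>f. coherent K1 s1 i f) \<and> (\<exists>f. coherent K2 s2 i f)"
  using coherent_vertex_product_imp[OF assms(1) _ assms(2,3)] coherent_vertex_product[OF assms(1)]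
  by metis

lemma ex_coherent_product_iff:
  assumes "i \<ge> 1" "u0 \<in> vertices K1" "v0 \<in> vertices K2"
  shows "(\<exists>f. coherent (K1 \<box> K2) s i f) \<longleftrightarrow> (\<exists>f. coherent K1 s1 i f) \<or> (\<exists>f. coherent K2 s2 i f)"
  using coherent_product_cases coherent_extend_left[OF assms(1) _ assms(3)]
    coherent_extend_right[OF assms(1) _ assms(2)] by metis

end

section \<open>Path connectedness of the product\<close>

lemma rtranclp_face_adjacent_sym:
  "(face_adjacent d K)\<^sup>*\<^sup>* F F' \<Longrightarrow> (face_adjacent d K)\<^sup>*\<^sup>* F' F"
  by (metis face_adjacent_sym sympI symp_rtranclp sympD)

lemma rtranclp_face_adjacent_Times_right:
  assumes "(face_adjacent d K1)\<^sup>*\<^sup>* F F'" "v \<in> vertices K2"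
  shows "(face_adjacent d (K1 \<box> K2))\<^sup>*\<^sup>* (F \<times> {v}) (F' \<times> {v})"
  using assms(1)
proof (induction rule: rtranclp_induct)
  case (step F1 F2)
  have "F1 \<times> {v} \<inter> F2 \<times> {v} = (F1 \<inter> F2) \<times> {v}" by blast
  with step.hyps(2) assms(2) have "face_adjacent d (K1 \<box> K2) (F1 \<times> {v}) (F2 \<times> {v})"
    by (auto simp: face_adjacent_def faces_cartesian_product)
  with step.IH show ?case by (rule rtranclp.rtrancl_into_rtrancl)
qed simp

lemma rtranclp_face_adjacent_Times_left:
  assumes "(face_adjacent d K2)\<^sup>*\<^sup>* F F'" "u \<in> vertices K1"
  shows "(face_adjacent d (K1 \<box> K2))\<^sup>*\<^sup>* ({u} \<times> F) ({u} \<times> F')"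
  using assms(1)
proof (induction rule: rtranclp_induct)
  case (step F1 F2)
  have "{u} \<times> F1 \<inter> {u} \<times> F2 = {u} \<times> (F1 \<inter> F2)" by blast
  with step.hyps(2) assms(2) have "face_adjacent d (K1 \<box> K2) ({u} \<times> F1) ({u} \<times> F2)"
    by (auto simp: face_adjacent_def faces_cartesian_product)
  with step.IH show ?case by (rule rtranclp.rtrancl_into_rtrancl)
qed simp

text \<open>Each horizontal layer meets each vertical one in a single vertex \<open>(u, v)\<close>.
  Edges through it in both layers are adjacent there, so moving inside a layer and crossing at that
  vertex joins any horizontal edge to any vertical one.\<close>

lemma cartesian_product_edge_connected:
  assumes K1: "simplicial_complex K1" and K2: "simplicial_complex K2"
    and conn1: "face_path_connected 1 K1" and conn2: "face_path_connected 1 K2"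
    and ne: "faces 1 K1 \<noteq> {}" "faces 1 K2 \<noteq> {}"
    and cov1: "\<forall>u\<in>vertices K1. \<exists>e\<in>faces 1 K1. u \<in> e"
    and cov2: "\<forall>v\<in>vertices K2. \<exists>e\<in>faces 1 K2. v \<in> e"
  shows "face_path_connected 1 (K1 \<box> K2)"
proof -
  let ?R = "(face_adjacent 1 (K1 \<box> K2))\<^sup>*\<^sup>*"
  have cross: "?R (G1 \<times> {v}) ({u} \<times> G2)"
    if G: "G1 \<in> faces 1 K1" "v \<in> vertices K2" "u \<in> vertices K1" "G2 \<in> faces 1 K2" for G1 v u G2
  proof -
    obtain e1 where e1: "e1 \<in> faces 1 K1" "u \<in> e1" using cov1 G(3) by blast
    obtain e2 where e2: "e2 \<in> faces 1 K2" "v \<in> e2" using cov2 G(2) by blast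
    have "?R (G1 \<times> {v}) (e1 \<times> {v})"
      using conn1 G e1 by (intro rtranclp_face_adjacent_Times_right) (auto simp: face_path_connected_iff)
    moreover have "face_adjacent 1 (K1 \<box> K2) (e1 \<times> {v}) ({u} \<times> e2)"
    proof -
      have "e1 \<times> {v} \<inter> {u} \<times> e2 = {u} \<times> {v}" using e1 e2 by auto
      moreover have "{v} \<in> faces 0 K2" using K2 e2 by (auto simp: simplicial_complex_def faces_def)
      then have "{u} \<times> {v} \<in> faces 0 (K1 \<box> K2)"
        unfolding faces_cartesian_product using G(3) by blast
      moreover have "e1 \<times> {v} \<in> faces 1 (K1 \<box> K2)" "{u} \<times> e2 \<in> faces 1 (K1 \<box> K2)"
        unfolding faces_cartesian_product using G e1 e2 by blast+
      ultimately show ?thesis by (simp add: face_adjacent_def)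
    qed
    moreover have "?R ({u} \<times> e2) ({u} \<times> G2)"
      using conn2 G e2 by (intro rtranclp_face_adjacent_Times_left) (auto simp: face_path_connected_iff)
    ultimately show ?thesis by (meson rtranclp.rtrancl_into_rtrancl rtranclp_trans)
  qed
  obtain e1 where e1: "e1 \<in> faces 1 K1" using ne by blast
  obtain e2 where e2: "e2 \<in> faces 1 K2" using ne by blast
  obtain u0 where u0: "u0 \<in> vertices K1" using face_obtain_vertex[OF e1] by blast
  obtain v0 where v0: "v0 \<in> vertices K2" using face_obtain_vertex[OF e2] by blast
  \<comment> \<open>Crossing handles edges of different kinds; a vertical edge reaches the vertical
    hub by a detour through the horizontal edge \<open>e1 \<times> {v0}\<close>.\<close>
  have hub: "?R H ({u0} \<times> e2)" if "H \<in> faces 1 (K1 \<box> K2)" for H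
    using that unfolding faces_cartesian_product
  proof (elim disjE exE conjE)
    fix F v assume "H = F \<times> {v}" "F \<in> faces 1 K1" "v \<in> vertices K2"
    with cross u0 e2 show ?thesis by blast
  next
    fix u F assume H: "H = {u} \<times> F" "u \<in> vertices K1" "F \<in> faces 1 K2"
    have "?R H (e1 \<times> {v0})" using cross[OF e1 v0 H(2,3)] H(1) rtranclp_face_adjacent_sym by blast
    also have "?R (e1 \<times> {v0}) ({u0} \<times> e2)" using cross e1 v0 u0 e2 by blast
    finally show ?thesis .
  qed
  have "?R H H'" if "H \<in> faces 1 (K1 \<box> K2)" "H' \<in> faces 1 (K1 \<box> K2)" for H H'
    using hub[OF that(1)] rtranclp_face_adjacent_sym[OF hub[OF that(2)]] by (rule rtranclp_trans)
  then show ?thesis by (simp add: face_path_connected_iff)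
qed

text \<open>Faces in a horizontal and a vertical layer share at most one vertex.\<close>

lemma cartesian_product_not_connected:
  assumes i: "i \<ge> 1" and ne: "faces (i + 1) K1 \<noteq> {}" "faces (i + 1) K2 \<noteq> {}"
  shows "\<not> face_path_connected (i + 1) (K1 \<box> K2)"
proof
  assume conn: "face_path_connected (i + 1) (K1 \<box> K2)"
  obtain G1 where G1: "G1 \<in> faces (i + 1) K1" using ne by blast
  obtain G2 where G2: "G2 \<in> faces (i + 1) K2" using ne by blast
  obtain u where u: "u \<in> vertices K1" using face_obtain_vertex[OF G1] by blast
  obtain v where v: "v \<in> vertices K2" using face_obtain_vertex[OF G2] by blast
  have "G1 \<times> {v} \<in> faces (i + 1) (K1 \<box> K2)" "{u} \<times> G2 \<in> faces (i + 1) (K1 \<box> K2)"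
    unfolding faces_cartesian_product using G1 G2 u v by blast+
  then have "(face_adjacent (i + 1) (K1 \<box> K2))\<^sup>*\<^sup>* (G1 \<times> {v}) ({u} \<times> G2)"
    using conn by (simp add: face_path_connected_iff)
  \<comment> \<open>Being horizontal is invariant along adjacency: consecutive faces share
    \<open>i + 1 \<ge> 2\<close> vertices, whereas a horizontal and a vertical face share at most
    one. The target face, with its several second coordinates, violates the invariant.\<close>
  then have "\<exists>F w. {u} \<times> G2 = F \<times> {w}"
  proof (induction rule: rtranclp_induct)
    case (step H H')
    then obtain F w where H: "H = F \<times> {w}" by blast
    have big: "card (H \<inter> H') = i + 1" and H': "H' \<in> faces (i + 1) (K1 \<box> K2)"
      using step.hyps(2) by (auto simp: face_adjacent_def faces_def)
    from H' show ?case unfolding faces_cartesian_product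
    proof (elim disjE exE conjE)
      fix u' F' assume "H' = {u'} \<times> F'"
      then have "H \<inter> H' \<subseteq> {(u', w)}" using H by auto
      then have "card (H \<inter> H') \<le> 1" using card_mono[of "{(u', w)}" "H \<inter> H'"] by simp
      with big i show ?thesis by simp
    qed blast
  qed blast
  then obtain F w where "{u} \<times> G2 = F \<times> {w}" by blast
  then have "G2 \<subseteq> {w}" by blast
  then have "card G2 \<le> 1" using card_mono[of "{w}" G2] by simp
  with G2 show False by (simp add: faces_def)
qed

theorem theorem4p7:
  fixes K1 :: "'a set set" and K2 :: "'b set set" and i :: nat
    and \<omega>1 :: "'a set \<Rightarrow> 'a list" and \<omega>2 :: "'b set \<Rightarrow> 'b list"
    and \<omega> :: "('a \<times> 'b) set \<Rightarrow> ('a \<times> 'b) list"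
  assumes "simplicial_complex K1" and "simplicial_complex K2"
    and "face_path_connected (i + 1) K1" and "face_path_connected (i + 1) K2"
    and "faces (i + 1) K1 \<noteq> {}" and "faces (i + 1) K2 \<noteq> {}"
    and "i = 0 \<Longrightarrow> \<forall>v\<in>vertices K1. \<exists>e\<in>faces 1 K1. v \<in> e"
    and "i = 0 \<Longrightarrow> \<forall>v\<in>vertices K2. \<exists>e\<in>faces 1 K2. v \<in> e"
    and "orientation K1 \<omega>1" and "orientation K2 \<omega>2" and "orientation (K1 \<box> K2) \<omega>"
  shows "(i = 0 \<longrightarrow>
           face_path_connected 1 (K1 \<box> K2) \<and>
           (lambda_max (K1 \<box> K2) \<omega> 0 = 2 \<longleftrightarrow>
              balanced (incidence_graph K1 \<omega>1 0) \<and> balanced (incidence_graph K2 \<omega>2 0))) \<and>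
         (i \<ge> 1 \<longrightarrow>
           \<not> face_path_connected (i + 1) (K1 \<box> K2) \<and>
           (lambda_max (K1 \<box> K2) \<omega> i = real i + 2 \<longleftrightarrow>
              balanced (incidence_graph K1 \<omega>1 i) \<or> balanced (incidence_graph K2 \<omega>2 i)))"
proof -
  note K1 = assms(1) and K2 = assms(2)
  obtain g g1 g2 where inj: "inj_on g (vertices K1 \<times> vertices K2)"
    and inj1: "inj_on g1 (vertices K1)" and inj2: "inj_on g2 (vertices K2)"
    and s1: "\<And>F G v. order_sign g (F \<times> {v}) (G \<times> {v}) = order_sign g1 F G"
    and s2: "\<And>F G u. order_sign g ({u} \<times> F) ({u} \<times> G) = order_sign g2 F G"
    using product_order_exists[of "vertices K1" "vertices K2"]
      simplicial_complex_finite_vertices[OF K1] simplicial_complex_finite_vertices[OF K2] by blast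
  have injp: "inj_on g (vertices (K1 \<box> K2))"
    using inj vertices_cartesian_product by (rule inj_on_subset)
  obtain u where u: "u \<in> vertices K1" using assms(5) face_obtain_vertex by blast
  obtain v where v: "v \<in> vertices K2" using assms(6) face_obtain_vertex by blast
  obtain F where "F \<in> faces i K1"
    using assms(5) subface_exists[OF K1, of _ i] by blast
  then have "F \<times> {v} \<in> faces i (K1 \<box> K2)" unfolding faces_cartesian_product using v by blast
  then have ne: "faces i (K1 \<box> K2) \<noteq> {}" by blast
  \<comment> \<open>From here on the product and both factors are described by signs of compatible
    vertex orders, and the three given orientations have disappeared.\<close>
  have lam: "lambda_max (K1 \<box> K2) \<omega> i = real i + 2 \<longleftrightarrow>
      (\<exists>f. coherent (K1 \<box> K2) (order_sign g) i f)"
    by (simp only: lambda_max_eq_iff[OF simplicial_complex_cartesian_product[OF K1 K2] ne]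
        coherent_incidence_sign_iff_order_sign[OF assms(11) injp])
  have bal1: "balanced (incidence_graph K1 \<omega>1 i) \<longleftrightarrow> (\<exists>f. coherent K1 (order_sign g1) i f)"
    by (simp only: balanced_iff_coherent[OF K1 assms(3,5)]
        coherent_incidence_sign_iff_order_sign[OF assms(9) inj1])
  have bal2: "balanced (incidence_graph K2 \<omega>2 i) \<longleftrightarrow> (\<exists>f. coherent K2 (order_sign g2) i f)"
    by (simp only: balanced_iff_coherent[OF K2 assms(4,6)]
        coherent_incidence_sign_iff_order_sign[OF assms(10) inj2])
  show ?thesis
  proof (intro conjI impI)
    assume i: "i = 0"
    have cov: "\<forall>u\<in>vertices K1. \<exists>e\<in>faces 1 K1. u \<in> e" "\<forall>v\<in>vertices K2. \<exists>e\<in>faces 1 K2. v \<in> e"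
      using assms(7,8) i by blast+
    show "face_path_connected 1 (K1 \<box> K2)"
      using cartesian_product_edge_connected[OF K1 K2 _ _ _ _ cov] assms(3-6) i by simp
    have "lambda_max (K1 \<box> K2) \<omega> i = real i + 2 \<longleftrightarrow>
        balanced (incidence_graph K1 \<omega>1 i) \<and> balanced (incidence_graph K2 \<omega>2 i)"
      unfolding lam bal1 bal2 by (intro ex_coherent_vertex_product_iff K1 K2 s1 s2 i cov)
    then show "lambda_max (K1 \<box> K2) \<omega> 0 = 2 \<longleftrightarrow>
        balanced (incidence_graph K1 \<omega>1 0) \<and> balanced (incidence_graph K2 \<omega>2 0)"
      by (simp add: i)
  next
    assume i: "i \<ge> 1"
    show "\<not> face_path_connected (i + 1) (K1 \<box> K2)"
      using i assms(5,6) by (rule cartesian_product_not_connected)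
    show "lambda_max (K1 \<box> K2) \<omega> i = real i + 2 \<longleftrightarrow>
        balanced (incidence_graph K1 \<omega>1 i) \<or> balanced (incidence_graph K2 \<omega>2 i)"
      unfolding lam bal1 bal2 by (intro ex_coherent_product_iff[where ?u0.0 = u and ?v0.0 = v] K1 K2 s1 s2 i u v)
  qed
qed

end
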